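(* Consider a block circulant MPC problem of order $n$ with data $A,B,C,D,Q,R$ and terminal cost matrix $P$ (all as in the context). Define the matrices $$\psi_x = F_n\otimes I_{n_x},\qquad \psi_u = F_n\otimes I_{n_u},\qquad \psi_y = I_p\otimes (F_n\otimes I_{n_y}).$$ Then the dynamics matrices decompose as $$\begin{bmatrix}\psi_x & 0\\ 0& \psi_y\end{bmatrix}^H\begin{bmatrix}A & B\\ C& D\end{bmatrix}\begin{bmatrix}\psi_x & 0\\ 0& \psi_u\end{bmatrix}=\begin{bmatrix}\hat A & \hat B\\ \hat C & \hat D\end{bmatrix},$$ where $\hat A=\mathrm{diag}\{\hat a_1,\dots,\hat a_n\}$, $\hat B=\mathrm{diag}\{\hat b_1,\dots,\hat b_n\}$, $$\hat C=\begin{bmatrix}\mathrm{diag}\{\hat c^1_1,\dots,\hat c^1_n\}\\ \vdots\\ \mathrm{diag}\{\hat c^p_1,\dots,\hat c^p_n\}\end{bmatrix},\qquad \hat D=\begin{bmatrix}\mathrm{diag}\{\hat d^1_1,\dots,\hat d^1_n\}\\ \vdots\\ \mathrm{diag}\{\hat d^p_1,\dots,\hat d^p_n\}\end{bmatrix};$$ the objective function matrices decompose as $$\begin{bmatrix}\psi_x & 0\\ 0& \psi_u\end{bmatrix}^H\begin{bmatrix}Q & 0\\ 0& R\end{bmatrix}\begin{bmatrix}\psi_x & 0\\ 0& \psi_u\end{bmatrix}=\begin{bmatrix}\hat Q & 0\\ 0 & \hat R\end{bmatrix},\qquad \hat Q=\mathrm{diag}\{\hat q_1,\dots,\hat q_n\},\quad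 \hat R=\mathrm{diag}\{\hat r_1,\dots,\hat r_n\};$$ and the terminal cost matrix decomposes as $$\hat P=\psi_x^H P\psi_x=\mathrm{diag}\{\hat p_1,\dots,\hat p_n\}.$$ Here $\mathrm{diag}\{\cdot\}$ denotes block diagonal matrices with complex blocks of sizes $\hat a_j,\hat q_j,\hat p_j\in\mathbb C^{n_x\times n_x}$, $\hat b_j\in\mathbb C^{n_x\times n_u}$, $\hat r_j\in\mathbb C^{n_u\times n_u}$, $\hat c^i_j\in\mathbb C^{n_y\times n_x}$, $\hat d^i_j\in\mathbb C^{n_y\times n_u}$.
   Context: $M^H$ denotes the Hermitian transpose, $\otimes$ the Kronecker product, $I_m$ the $m\times m$ identity. Fourier matrix: $F_n=\frac1{\sqrt n}[w_0\; w_1\;\dots\; w_{n-1}]\in\mathbb C^{n\times n}$ with columns $w_j=(1,\rho_j,\rho_j^2,\dots,\rho_j^{n-1})^T$, $\rho_j=e^{2\pi i j/n}$. Block circulant matrices: $\mathcal{BC}(n,p,m)\subseteq\mathbb R^{np\times nm}$ is the set of real $n\times n$ block matrices with blocks of size $p\times m$ whose first block row is $(b_0,b_1,\dots,b_{n-1})$ and in which each block row is the cyclic shift by one block to the right of the previous one, i.e. the $(r,s)$ block is $b_{(s-r)\bmod n}$. Block circulant MPC problem of order $n$: the problem $$\min \sum_{k=0}^{T-1}\left(x_k^TQx_k+u_k^TRu_k\right)+x_T^TPx_T\quad\text{s.t. } x_{k+1}=Ax_k+Bu_k,\; x_0=x(t),\; y_k=Cx_k+Du_k,\; \underline y\le y_k\le\bar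 y,\; k=0,\dots,T-1,$$ with $x_k\in\mathbb R^{nn_x}$, $u_k\in\mathbb R^{nn_u}$, $y_k\in\mathbb R^{pnn_y}$, $p$ a positive integer, where $C$ and $D$ are partitioned as vertical stacks of $p$ blocks $C_1,\dots,C_p$ and $D_1,\dots,D_p$, and $A,Q\in\mathcal{BC}(n,n_x,n_x)$, $B\in\mathcal{BC}(n,n_x,n_u)$, $R\in\mathcal{BC}(n,n_u,n_u)$, $C_i\in\mathcal{BC}(n,n_y,n_x)$, $D_i\in\mathcal{BC}(n,n_y,n_u)$ for $i=1,\dots,p$. Standing assumptions: $R=R^T\succ0$, $Q=Q^T\succeq0$, $(A,B)$ is controllable, $(A,Q^{1/2})$ is observable, and $P=P^T\succ0$ is the solution of the discrete-time algebraic Riccati equation $$A^TPA-A^TPB(B^TPB+R)^{-1}B^TPA+Q=P.$$ *)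

theory Defs
  imports
    Complex_Main
    "Jordan_Normal_Form.Gauss_Jordan_Elimination"
    "Jordan_Normal_Form.Schur_Decomposition"
begin

text \<open>All indices (of blocks, rows, columns) start at \<open>0\<close>.\<close>

section \<open>Matrices\<close>

definition fourier_mat :: "nat \<Rightarrow> complex mat" where
  "fourier_mat n = mat n n
     (\<lambda>(k, j). 1 / complex_of_real (sqrt (real n)) *
               exp (2 * complex_of_real pi * \<i> * of_nat j / of_nat n) ^ k)"

definition kronecker :: "'a :: times mat \<Rightarrow> 'a mat \<Rightarrow> 'a mat" (infixl \<open>\<otimes>\<^sub>K\<close> 70) where
  "M \<otimes>\<^sub>K N = mat (dim_row M * dim_row N) (dim_col M * dim_col N)
     (\<lambda>(i, j). M $$ (i div dim_row N, j div dim_col N) * N $$ (i mod dim_row N, j mod dim_col N))"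

text \<open>The number of columns is a parameter so that the empty stack has a well-defined format.\<close>

definition stack_rows :: "nat \<Rightarrow> 'a :: zero mat list \<Rightarrow> 'a mat" where
  "stack_rows nc Ms = foldr (@\<^sub>r) Ms (0\<^sub>m 0 nc)"

definition block_of :: "nat \<Rightarrow> nat \<Rightarrow> 'a mat \<Rightarrow> nat \<Rightarrow> nat \<Rightarrow> 'a mat" where
  "block_of p m M r s = mat p m (\<lambda>(i, j). M $$ (r * p + i, s * m + j))"

text \<open>For \<open>r, s < n\<close> the natural number \<open>(s + n - r) mod n\<close> is the residue of \<open>s - r\<close> modulo \<open>n\<close>.\<close>

definition block_circulant :: "nat \<Rightarrow> nat \<Rightarrow> nat \<Rightarrow> real mat set" where
  "block_circulant n p m = {M \<in> carrier_mat (n * p) (n * m).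
     \<exists>b. (\<forall>k<n. b k \<in> carrier_mat p m) \<and>
         (\<forall>r<n. \<forall>s<n. block_of p m M r s = b ((s + n - r) mod n))}"

definition pos_def :: "nat \<Rightarrow> real mat \<Rightarrow> bool" where
  "pos_def N M \<longleftrightarrow> M \<in> carrier_mat N N \<and> transpose_mat M = M \<and>
     (\<forall>v \<in> carrier_vec N. v \<noteq> 0\<^sub>v N \<longrightarrow> v \<bullet> (M *\<^sub>v v) > 0)"

definition pos_semidef :: "nat \<Rightarrow> real mat \<Rightarrow> bool" where
  "pos_semidef N M \<longleftrightarrow> M \<in> carrier_mat N N \<and> transpose_mat M = M \<and>
     (\<forall>v \<in> carrier_vec N. v \<bullet> (M *\<^sub>v v) \<ge> 0)"

text \<open>\<open>S\<close> is the (unique) symmetric positive semidefinite square root \<open>M\<^bsup>1/2\<^esup>\<close> of \<open>M\<close>.\<close>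

definition is_psd_sqrt :: "nat \<Rightarrow> real mat \<Rightarrow> real mat \<Rightarrow> bool" where
  "is_psd_sqrt N S M \<longleftrightarrow> pos_semidef N S \<and> S * S = M"


section \<open>Linear discrete-time systems\<close>

primrec state_at :: "real mat \<Rightarrow> real mat \<Rightarrow> real vec \<Rightarrow> (nat \<Rightarrow> real vec) \<Rightarrow> nat \<Rightarrow> real vec" where
  "state_at A B x0 u 0 = x0"
| "state_at A B x0 u (Suc k) = A *\<^sub>v state_at A B x0 u k + B *\<^sub>v u k"

definition controllable :: "real mat \<Rightarrow> real mat \<Rightarrow> bool" where
  "controllable A B \<longleftrightarrow>
     (\<forall>x0 \<in> carrier_vec (dim_row A). \<forall>x1 \<in> carrier_vec (dim_row A).
        \<exists>k u. (\<forall>i. u i \<in> carrier_vec (dim_col B)) \<and> state_at A B x0 u k = x1)"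

text \<open>The output sequence \<open>C x\<^sub>k\<close> of \<open>x\<^sub>k\<^sub>+\<^sub>1 = A x\<^sub>k\<close> determines the initial state.\<close>

definition observable :: "real mat \<Rightarrow> real mat \<Rightarrow> bool" where
  "observable A C \<longleftrightarrow>
     (\<forall>x \<in> carrier_vec (dim_row A). \<forall>x' \<in> carrier_vec (dim_row A).
        (\<forall>k. C *\<^sub>v ((A ^\<^sub>m k) *\<^sub>v x) = C *\<^sub>v ((A ^\<^sub>m k) *\<^sub>v x')) \<longrightarrow> x = x')"

text \<open>If \<open>P\<close> and \<open>R\<close> are positive definite, then so is \<open>B\<^sup>T P B + R\<close>; hence
  \<^const>\<open>mat_inverse\<close> does not return \<^const>\<open>None\<close> in that case.\<close>

definition solves_dare ::
    "real mat \<Rightarrow> real mat \<Rightarrow> real mat \<Rightarrow> real mat \<Rightarrow> real mat \<Rightarrow> bool" where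
  "solves_dare A B Q R P \<longleftrightarrow>
     transpose_mat A * P * A
     - transpose_mat A * P * B * the (mat_inverse (transpose_mat B * P * B + R))
         * transpose_mat B * P * A
     + Q = P"


section \<open>Model predictive control problems\<close>

record mpc_problem =
  horizon :: nat
  init_state :: "real vec"
  mat_A :: "real mat"
  mat_B :: "real mat"
  mat_C :: "real mat"
  mat_D :: "real mat"
  cost_Q :: "real mat"
  cost_R :: "real mat"
  cost_P :: "real mat"
  y_lower :: "real vec"
  y_upper :: "real vec"

definition mpc_feasible :: "mpc_problem \<Rightarrow> (nat \<Rightarrow> real vec) \<Rightarrow> (nat \<Rightarrow> real vec) \<Rightarrow> bool" where
  "mpc_feasible M x u \<longleftrightarrow> x 0 = init_state M \<and>
     (\<forall>k < horizon M.
        u k \<in> carrier_vec (dim_col (mat_B M)) \<and>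
        x (Suc k) = mat_A M *\<^sub>v x k + mat_B M *\<^sub>v u k \<and>
        y_lower M \<le> mat_C M *\<^sub>v x k + mat_D M *\<^sub>v u k \<and>
        mat_C M *\<^sub>v x k + mat_D M *\<^sub>v u k \<le> y_upper M)"

definition mpc_cost :: "mpc_problem \<Rightarrow> (nat \<Rightarrow> real vec) \<Rightarrow> (nat \<Rightarrow> real vec) \<Rightarrow> real" where
  "mpc_cost M x u =
     (\<Sum>k < horizon M. x k \<bullet> (cost_Q M *\<^sub>v x k) + u k \<bullet> (cost_R M *\<^sub>v u k))
     + x (horizon M) \<bullet> (cost_P M *\<^sub>v x (horizon M))"

definition mpc_optimal :: "mpc_problem \<Rightarrow> (nat \<Rightarrow> real vec) \<Rightarrow> (nat \<Rightarrow> real vec) \<Rightarrow> bool" where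
  "mpc_optimal M x u \<longleftrightarrow>
     is_arg_min (\<lambda>(x, u). mpc_cost M x u) (\<lambda>(x, u). mpc_feasible M x u) (x, u)"

definition block_circulant_mpc ::
    "nat \<Rightarrow> nat \<Rightarrow> nat \<Rightarrow> nat \<Rightarrow> nat \<Rightarrow> mpc_problem \<Rightarrow> bool" where
  "block_circulant_mpc n p nx nu ny M \<longleftrightarrow> n > 0 \<and> p > 0 \<and>
     init_state M \<in> carrier_vec (n * nx) \<and>
     y_lower M \<in> carrier_vec (p * n * ny) \<and> y_upper M \<in> carrier_vec (p * n * ny) \<and>
     mat_A M \<in> block_circulant n nx nx \<and>
     mat_B M \<in> block_circulant n nx nu \<and>
     cost_Q M \<in> block_circulant n nx nx \<and>
     cost_R M \<in> block_circulant n nu nu \<and>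
     cost_P M \<in> carrier_mat (n * nx) (n * nx) \<and>
     (\<exists>C. (\<forall>i<p. C i \<in> block_circulant n ny nx) \<and>
          mat_C M = stack_rows (n * nx) (map C [0..<p])) \<and>
     (\<exists>D. (\<forall>i<p. D i \<in> block_circulant n ny nu) \<and>
          mat_D M = stack_rows (n * nu) (map D [0..<p]))"

end

theory Submission
  imports Defs "HOL-Analysis.Function_Topology"
begin

text \<open>
  Let \<open>\<sigma>\<close> be the cyclic shift by one block. A block matrix is block circulant precisely when
  \<open>M(\<sigma> i, \<sigma> j) = M(i, j)\<close> for all indices, that is, when it commutes with the block shift; this
  property is \<open>shift_invariant\<close>. The columns of \<open>F\<^sub>n \<otimes> I\<close> are eigenvectors of the shift, and two
  columns have the same eigenvalue exactly if they belong to the same block. Hence a congruence by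
  Fourier matrices takes every shift-invariant matrix to a block diagonal one
  (\<open>fourier_transform_block_diagonal\<close>): reindexing the double sum for an entry by \<open>\<sigma>\<close> multiplies it
  by the quotient of two distinct eigenvalues, so outside the diagonal blocks it vanishes. The
  matrices \<open>A\<close>, \<open>B\<close>, \<open>Q\<close>, \<open>R\<close>, \<open>C\<^sub>i\<close> and \<open>D\<^sub>i\<close> are shift invariant by hypothesis, and the rest is the
  calculus of block matrices.

  The substance lies in the terminal cost: nothing is said about the structure of \<open>P\<close>, and its shift
  invariance has to be extracted from the Riccati equation. The data of the problem are
  unchanged by the shift, so the shifted matrix \<open>P(\<sigma> i, \<sigma> j)\<close> plays the same role as \<open>P\<close>, and it
  suffices that the positive definite solution is unique. For this the Riccati equation is used only through
  dynamic programming: completing the square (\<open>dare_completion_of_squares\<close>) shows that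
  \<open>V(x) = x\<^sup>T P x\<close> solves the Bellman equation
  \<open>V(x) = min\<^sub>u (x\<^sup>T Q x + u\<^sup>T R u + V(A x + B u))\<close>, which is visibly invariant under shifts.

  Two positive definite solutions \<open>V\<^sub>1\<close> and \<open>V\<^sub>2\<close> of the Bellman equation agree
  (\<open>bellman_solution_unique\<close>). Suppose that the maximum \<open>t\<close> of \<open>V\<^sub>2 / V\<^sub>1\<close> exceeds \<open>1\<close>, and let \<open>x\<close> attain it.
  With the control \<open>u\<close> that is optimal for \<open>V\<^sub>1\<close>, the stage cost \<open>l\<close> and the successor state \<open>y\<close>,
  \<open>t (l + V\<^sub>1(y)) = t V\<^sub>1(x) = V\<^sub>2(x) \<le> l + V\<^sub>2(y) \<le> l + t V\<^sub>1(y)\<close>, so \<open>l = 0\<close>. Therefore \<open>u = 0\<close>,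
  \<open>Q\<^sup>1\<^sup>/\<^sup>2 x = 0\<close>, and \<open>y = A x\<close> attains the maximum again. By induction the output
  \<open>Q\<^sup>1\<^sup>/\<^sup>2 A\<^sup>k x\<close> vanishes for all \<open>k\<close>, and observability forces \<open>x = 0\<close>, a contradiction.
\<close>

section \<open>Quadratic forms\<close>

definition quad_form :: "real mat \<Rightarrow> real vec \<Rightarrow> real" where
  "quad_form M x = x \<bullet> (M *\<^sub>v x)"

lemma scalar_prod_mult_mat_vec:
  fixes M :: "real mat"
  assumes "M \<in> carrier_mat k l" "v \<in> carrier_vec k" "w \<in> carrier_vec l"
  shows "v \<bullet> (M *\<^sub>v w) = (transpose_mat M *\<^sub>v v) \<bullet> w"
  using assms transpose_vec_mult_scalar[of M k l w v]
  by (metis)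

lemma quad_form_add:
  assumes "M \<in> carrier_mat k k" "transpose_mat M = M" "v \<in> carrier_vec k" "w \<in> carrier_vec k"
  shows "quad_form M (v + w) = quad_form M v + 2 * (v \<bullet> (M *\<^sub>v w)) + quad_form M w"
proof -
  have c: "M *\<^sub>v v \<in> carrier_vec k" "M *\<^sub>v w \<in> carrier_vec k" using assms by auto
  have "w \<bullet> (M *\<^sub>v v) = v \<bullet> (M *\<^sub>v w)"
    using scalar_prod_mult_mat_vec[OF assms(1,4,3)] assms c by (simp add: comm_scalar_prod)
  then show ?thesis
    unfolding quad_form_def using assms c
    by (simp add: mult_add_distrib_mat_vec add_scalar_prod_distrib[of _ k] scalar_prod_add_distrib[of _ k])
qed

lemma mult_mat_zero_vec: "(M :: real mat) \<in> carrier_mat k l \<Longrightarrow> M *\<^sub>v 0\<^sub>v l = 0\<^sub>v k"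
  by (intro eq_vecI) auto

lemma quad_form_smult:
  assumes "M \<in> carrier_mat k k" "v \<in> carrier_vec k"
  shows "quad_form M (c \<cdot>\<^sub>v v) = c\<^sup>2 * quad_form M v"
  using assms unfolding quad_form_def by (simp add: mult_mat_vec power2_eq_square)

lemma quad_form_as_sum:
  assumes "M \<in> carrier_mat k k"
  shows "quad_form M (vec k f) = (\<Sum>i<k. f i * (\<Sum>j<k. M $$ (i,j) * f j))"
  using assms unfolding quad_form_def by (auto simp: scalar_prod_def row_def lessThan_atLeast0)

lemma pos_def_carrier: "pos_def k M \<Longrightarrow> M \<in> carrier_mat k k"
  and pos_def_sym: "pos_def k M \<Longrightarrow> transpose_mat M = M"
  by (auto simp: pos_def_def)

lemma pos_def_pos: "pos_def k M \<Longrightarrow> v \<in> carrier_vec k \<Longrightarrow> v \<noteq> 0\<^sub>v k \<Longrightarrow> quad_form M v > 0"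
  by (auto simp: pos_def_def quad_form_def)

lemma quad_form_zero: "M \<in> carrier_mat k k \<Longrightarrow> quad_form M (0\<^sub>v k) = 0"
  by (simp add: quad_form_def)

lemma pos_def_nonneg: "pos_def k M \<Longrightarrow> v \<in> carrier_vec k \<Longrightarrow> quad_form M v \<ge> 0"
  using pos_def_pos[of k M v] quad_form_zero[of M k] pos_def_carrier by (cases "v = 0\<^sub>v k") (auto simp: less_imp_le)

lemma pos_def_zero_iff: "pos_def k M \<Longrightarrow> v \<in> carrier_vec k \<Longrightarrow> quad_form M v = 0 \<longleftrightarrow> v = 0\<^sub>v k"
  using pos_def_pos[of k M v] quad_form_zero[of M k] pos_def_carrier by fastforce

lemma pos_def_mat_inverse:
  assumes "pos_def k M"
  shows "M * the (mat_inverse M) = 1\<^sub>m k" "the (mat_inverse M) \<in> carrier_mat k k"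
proof -
  have M: "M \<in> carrier_mat k k" using assms by (rule pos_def_carrier)
  have "det M \<noteq> 0"
  proof
    assume "det M = 0"
    then obtain v where v: "v \<in> carrier_vec k" "v \<noteq> 0\<^sub>v k" "M *\<^sub>v v = 0\<^sub>v k"
      using det_0_iff_vec_prod_zero_field[OF M] by auto
    with assms show False by (auto simp: pos_def_def)
  qed
  then have "M \<in> Units (ring_mat TYPE(real) k ())"
    by (rule det_non_zero_imp_unit[OF M])
  then obtain Mi where "mat_inverse M = Some Mi"
    using mat_inverse(1)[OF M, of "()"] by (cases "mat_inverse M") auto
  with mat_inverse(2)[OF M this] show "M * the (mat_inverse M) = 1\<^sub>m k" "the (mat_inverse M) \<in> carrier_mat k k"
    by auto
qed

section \<open>The Riccati equation as a Bellman equation\<close>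

text \<open>
  With \<open>M = B\<^sup>T P B + R\<close> and the optimal feedback gain \<open>K = M\<^sup>-\<^sup>1 B\<^sup>T P A\<close>, the cost of applying \<open>u\<close> and
  continuing with the terminal cost \<open>P\<close> is quadratic in \<open>u\<close> with leading part \<open>u\<^sup>T M u\<close> and critical point
  \<open>u = - K x\<close>; the Riccati equation says that its value there is \<open>x\<^sup>T P x\<close>.
\<close>

lemma dare_completion_of_squares:
  assumes A: "A \<in> carrier_mat N N" and B: "B \<in> carrier_mat N m" and Q: "Q \<in> carrier_mat N N"
    and R: "pos_def m R" and P: "pos_def N P" and dare: "solves_dare A B Q R P"
  obtains M K where "pos_def m M" "K \<in> carrier_mat m N"
    "\<And>x u. x \<in> carrier_vec N \<Longrightarrow> u \<in> carrier_vec m \<Longrightarrow>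
       quad_form Q x + quad_form R u + quad_form P (A *\<^sub>v x + B *\<^sub>v u)
         = quad_form P x + quad_form M (u + K *\<^sub>v x)"
proof -
  define M where "M = transpose_mat B * P * B + R"
  define Mi where "Mi = the (mat_inverse M)"
  define K where "K = Mi * transpose_mat B * P * A"
  note Pc = pos_def_carrier[OF P] and Rc = pos_def_carrier[OF R]
  have AT: "transpose_mat A \<in> carrier_mat N N" and BT: "transpose_mat B \<in> carrier_mat m N"
    using A B by auto
  have Mc: "M \<in> carrier_mat m m" unfolding M_def using Pc Rc B BT by auto
  have M_quad: "quad_form M u = quad_form P (B *\<^sub>v u) + quad_form R u" if u: "u \<in> carrier_vec m" for u
  proof -
    have c: "B *\<^sub>v u \<in> carrier_vec N" "P *\<^sub>v (B *\<^sub>v u) \<in> carrier_vec N"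
      "transpose_mat B *\<^sub>v (P *\<^sub>v (B *\<^sub>v u)) \<in> carrier_vec m" "R *\<^sub>v u \<in> carrier_vec m"
      using u B Pc BT Rc by auto
    have BTP: "transpose_mat B * P \<in> carrier_mat m N" and BTPB: "transpose_mat B * P * B \<in> carrier_mat m m"
      using BT Pc B by auto
    have "M *\<^sub>v u = transpose_mat B *\<^sub>v (P *\<^sub>v (B *\<^sub>v u)) + R *\<^sub>v u"
      unfolding M_def add_mult_distrib_mat_vec[OF BTPB Rc u] assoc_mult_mat_vec[OF BTP B u]
        assoc_mult_mat_vec[OF BT Pc c(1)] ..
    then show ?thesis unfolding quad_form_def
      using c u scalar_prod_mult_mat_vec[OF BT u c(2)] by (simp add: scalar_prod_add_distrib[of _ m])
  qed
  have M: "pos_def m M"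
    unfolding pos_def_def
  proof (intro conjI ballI impI)
    have BTP: "transpose_mat B * P \<in> carrier_mat m N" and BTPB: "transpose_mat B * P * B \<in> carrier_mat m m"
      using BT Pc B by auto
    show "transpose_mat M = M"
      unfolding M_def transpose_add[OF BTPB Rc] transpose_mult[OF BTP B] transpose_mult[OF BT Pc]
        pos_def_sym[OF P] pos_def_sym[OF R] transpose_transpose
      unfolding assoc_mult_mat[OF BT Pc B] ..
    fix v :: "real vec" assume v: "v \<in> carrier_vec m" "v \<noteq> 0\<^sub>v m"
    have "quad_form M v > 0" using M_quad[OF v(1)] pos_def_pos[OF R v] pos_def_nonneg[OF P, of "B *\<^sub>v v"] B v
      by auto
    then show "v \<bullet> (M *\<^sub>v v) > 0" by (simp add: quad_form_def)
  qed (rule Mc)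
  note Mi = pos_def_mat_inverse[OF M, folded Mi_def]
  have Kc: "K \<in> carrier_mat m N" unfolding K_def using Mi BT Pc A by auto
  show thesis
  proof (rule that[OF M Kc])
    fix x u :: "real vec" assume x: "x \<in> carrier_vec N" and u: "u \<in> carrier_vec m"
    \<comment> \<open>Here \<open>z\<close> and \<open>y\<close> are the uncontrolled and the controlled part of the successor state, and \<open>w = K x\<close>.\<close>
    define z y g w where "z = A *\<^sub>v x" and "y = B *\<^sub>v u" and "g = transpose_mat B *\<^sub>v (P *\<^sub>v z)"
      and "w = Mi *\<^sub>v g"
    have c: "z \<in> carrier_vec N" "y \<in> carrier_vec N" "g \<in> carrier_vec m" "w \<in> carrier_vec m"
      "P *\<^sub>v z \<in> carrier_vec N" "Q *\<^sub>v x \<in> carrier_vec N" "B *\<^sub>v w \<in> carrier_vec N"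
      "P *\<^sub>v (B *\<^sub>v w) \<in> carrier_vec N"
      unfolding z_def y_def g_def w_def using A B BT Mi Pc Q x u by auto
    have BTP: "Mi * transpose_mat B \<in> carrier_mat m N" "Mi * transpose_mat B * P \<in> carrier_mat m N"
      using Mi(2) BT Pc by auto
    have Kx: "K *\<^sub>v x = w"
      unfolding K_def assoc_mult_mat_vec[OF BTP(2) A x] assoc_mult_mat_vec[OF BTP(1) Pc c(1)[unfolded z_def]]
        assoc_mult_mat_vec[OF Mi(2) BT c(5)[unfolded z_def]] w_def g_def z_def ..
    have Mw: "M *\<^sub>v w = g"
      unfolding w_def using Mi Mc c(3) by (simp flip: assoc_mult_mat_vec)
    have Px: "P *\<^sub>v x = transpose_mat A *\<^sub>v (P *\<^sub>v z) - transpose_mat A *\<^sub>v (P *\<^sub>v (B *\<^sub>v w)) + Q *\<^sub>v x"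
    proof -
      \<comment> \<open>The partial products of the term that contains the inverse; naming them fixes the format in which each factor is split off.\<close>
      define X1 X2 X3 X4 X5 where "X1 = transpose_mat A * P" and "X2 = X1 * B" and "X3 = X2 * Mi"
        and "X4 = X3 * transpose_mat B" and "X5 = X4 * P"
      have X1: "X1 \<in> carrier_mat N N" unfolding X1_def using AT Pc by auto
      have X2: "X2 \<in> carrier_mat N m" unfolding X2_def using X1 B by auto
      have X3: "X3 \<in> carrier_mat N m" unfolding X3_def using X2 Mi(2) by auto
      have X4: "X4 \<in> carrier_mat N N" unfolding X4_def using X3 BT by auto
      have X5: "X5 \<in> carrier_mat N N" unfolding X5_def using X4 Pc by auto
      have X1A: "X1 * A \<in> carrier_mat N N" and X5A: "X5 * A \<in> carrier_mat N N"
        using X1 X5 A by auto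
      have "P *\<^sub>v x = (X1 * A - X5 * A + Q) *\<^sub>v x"
        using dare unfolding solves_dare_def X1_def X2_def X3_def X4_def X5_def Mi_def M_def by simp
      also have "\<dots> = (X1 * A) *\<^sub>v x - (X5 * A) *\<^sub>v x + Q *\<^sub>v x"
        unfolding add_mult_distrib_mat_vec[OF minus_carrier_mat[OF X5A] Q x]
          minus_mult_distrib_mat_vec[OF X1A X5A x] ..
      also have "(X1 * A) *\<^sub>v x = transpose_mat A *\<^sub>v (P *\<^sub>v z)"
        unfolding assoc_mult_mat_vec[OF X1 A x] z_def[symmetric]
        unfolding X1_def assoc_mult_mat_vec[OF AT Pc c(1)] ..
      also have "(X5 * A) *\<^sub>v x = X3 *\<^sub>v g"
        unfolding assoc_mult_mat_vec[OF X5 A x] z_def[symmetric]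
        unfolding X5_def assoc_mult_mat_vec[OF X4 Pc c(1)]
        unfolding X4_def assoc_mult_mat_vec[OF X3 BT c(5)] g_def ..
      also have "\<dots> = transpose_mat A *\<^sub>v (P *\<^sub>v (B *\<^sub>v w))"
        unfolding X3_def assoc_mult_mat_vec[OF X2 Mi(2) c(3)] w_def[symmetric]
        unfolding X2_def assoc_mult_mat_vec[OF X1 B c(4)]
        unfolding X1_def assoc_mult_mat_vec[OF AT Pc c(7)] ..
      finally show ?thesis .
    qed
    have gw: "z \<bullet> (P *\<^sub>v (B *\<^sub>v w)) = g \<bullet> w"
    proof -
      have "z \<bullet> (P *\<^sub>v (B *\<^sub>v w)) = (P *\<^sub>v z) \<bullet> (B *\<^sub>v w)"
        using scalar_prod_mult_mat_vec[OF Pc c(1,7)] pos_def_sym[OF P] by simp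
      also have "\<dots> = g \<bullet> w" unfolding g_def using scalar_prod_mult_mat_vec[OF B c(5,4)] .
      finally show ?thesis .
    qed
    have "quad_form P x = x \<bullet> (transpose_mat A *\<^sub>v (P *\<^sub>v z))
        - x \<bullet> (transpose_mat A *\<^sub>v (P *\<^sub>v (B *\<^sub>v w))) + quad_form Q x"
      unfolding quad_form_def Px using c AT x
      by (simp add: scalar_prod_add_distrib[of _ N] scalar_prod_minus_distrib[of _ N])
    also have "x \<bullet> (transpose_mat A *\<^sub>v (P *\<^sub>v z)) = quad_form P z"
      using scalar_prod_mult_mat_vec[OF AT x c(5)] unfolding quad_form_def z_def by simp
    also have "x \<bullet> (transpose_mat A *\<^sub>v (P *\<^sub>v (B *\<^sub>v w))) = g \<bullet> w"
      using scalar_prod_mult_mat_vec[OF AT x c(8)] gw unfolding z_def by simp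
    finally have Vx: "quad_form P x = quad_form P z - g \<bullet> w + quad_form Q x" .
    have zy: "z \<bullet> (P *\<^sub>v y) = u \<bullet> g"
    proof -
      have "z \<bullet> (P *\<^sub>v y) = (P *\<^sub>v z) \<bullet> y"
        using scalar_prod_mult_mat_vec[OF Pc c(1,2)] pos_def_sym[OF P] by simp
      also have "\<dots> = g \<bullet> u" unfolding g_def y_def using scalar_prod_mult_mat_vec[OF B c(5) u] .
      finally show ?thesis using comm_scalar_prod[OF c(3) u] by simp
    qed
    have Vy: "quad_form P (z + y) = quad_form P z + 2 * (u \<bullet> g) + quad_form P y"
      using quad_form_add[OF Pc pos_def_sym[OF P] c(1,2)] zy by simp
    have "quad_form M (u + w) = quad_form M u + 2 * (u \<bullet> g) + g \<bullet> w"
      using quad_form_add[OF Mc pos_def_sym[OF M] u c(4)] Mw comm_scalar_prod[OF c(3,4)]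
      by (simp add: quad_form_def)
    then show "quad_form Q x + quad_form R u + quad_form P (A *\<^sub>v x + B *\<^sub>v u)
         = quad_form P x + quad_form M (u + K *\<^sub>v x)"
      using Vx Vy M_quad[OF u] unfolding Kx by (simp add: z_def y_def)
  qed
qed

text \<open>
  The equation \<open>V(x) = min\<^sub>u (x\<^sup>T Q x + u\<^sup>T R u + V(A x + B u))\<close> for \<open>V(x) = x\<^sup>T P x\<close>, in the form of a lower
  bound that is attained. Unlike the Riccati equation it contains no inverse, and a change of
  coordinates in state and input space acts on it in an obvious way.
\<close>

definition solves_bellman ::
    "real mat \<Rightarrow> real mat \<Rightarrow> real mat \<Rightarrow> real mat \<Rightarrow> real mat \<Rightarrow> bool" where
  "solves_bellman A B Q R P \<longleftrightarrow>
     (\<forall>x \<in> carrier_vec (dim_row A).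
        (\<forall>u \<in> carrier_vec (dim_col B).
           quad_form P x \<le> quad_form Q x + quad_form R u + quad_form P (A *\<^sub>v x + B *\<^sub>v u)) \<and>
        (\<exists>u \<in> carrier_vec (dim_col B).
           quad_form P x = quad_form Q x + quad_form R u + quad_form P (A *\<^sub>v x + B *\<^sub>v u)))"

lemma solves_dare_imp_solves_bellman:
  assumes A: "A \<in> carrier_mat N N" and B: "B \<in> carrier_mat N m" and Q: "Q \<in> carrier_mat N N"
    and R: "pos_def m R" and P: "pos_def N P" and dare: "solves_dare A B Q R P"
  shows "solves_bellman A B Q R P"
proof -
  obtain M K where M: "pos_def m M" and K: "K \<in> carrier_mat m N" and
    eq: "\<And>x u. x \<in> carrier_vec N \<Longrightarrow> u \<in> carrier_vec m \<Longrightarrow>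
       quad_form Q x + quad_form R u + quad_form P (A *\<^sub>v x + B *\<^sub>v u)
         = quad_form P x + quad_form M (u + K *\<^sub>v x)"
    using dare_completion_of_squares[OF assms] by blast
  show ?thesis unfolding solves_bellman_def
  proof (intro ballI conjI)
    fix x u :: "real vec" assume "x \<in> carrier_vec (dim_row A)" "u \<in> carrier_vec (dim_col B)"
    then have xu: "x \<in> carrier_vec N" "u \<in> carrier_vec m" using A B by auto
    then have "u + K *\<^sub>v x \<in> carrier_vec m" using K by auto
    from eq[OF xu] pos_def_nonneg[OF M this]
    show "quad_form P x \<le> quad_form Q x + quad_form R u + quad_form P (A *\<^sub>v x + B *\<^sub>v u)" by simp
  next
    fix x :: "real vec" assume "x \<in> carrier_vec (dim_row A)"
    then have x: "x \<in> carrier_vec N" using A by auto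
    let ?u = "- (K *\<^sub>v x)"
    have u: "?u \<in> carrier_vec m" using K x by auto
    have "?u + K *\<^sub>v x = 0\<^sub>v m" using K x by auto
    then have "quad_form M (?u + K *\<^sub>v x) = 0" using quad_form_zero pos_def_carrier[OF M] by auto
    with eq[OF x u] show "\<exists>u \<in> carrier_vec (dim_col B).
           quad_form P x = quad_form Q x + quad_form R u + quad_form P (A *\<^sub>v x + B *\<^sub>v u)"
      using u B by (intro bexI[of _ ?u]) auto
  qed
qed

section \<open>Uniqueness of the positive definite Bellman solution\<close>

text \<open>
  The ratio of the two forms is homogeneous of degree \<open>0\<close>, so its values on the unit sphere, which is
  compact, are all its values. The sphere is realised inside the product topology on
  \<open>nat \<Rightarrow> real\<close>, by functions that are undefined from \<open>N\<close> on.
\<close>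

lemma max_quad_form_ratio:
  assumes P1: "pos_def N P1" and P2: "pos_def N P2" and N: "N > 0"
  obtains t y where "y \<in> carrier_vec N" "y \<noteq> 0\<^sub>v N" "quad_form P2 y = t * quad_form P1 y"
    "\<And>x. x \<in> carrier_vec N \<Longrightarrow> quad_form P2 x \<le> t * quad_form P1 x"
proof -
  define S :: "(nat \<Rightarrow> real) set" where
    "S = PiE {..<N} (\<lambda>_. {-1..1}) \<inter> {f. (\<Sum>i<N. (f i)\<^sup>2) = 1}"
  define g where "g f = quad_form P2 (vec N f) / quad_form P1 (vec N f)" for f
  have box: "compact (PiE {..<N} (\<lambda>_. {-1..1::real}))"
  proof -
    define I where "I i = (if i < N then {-1..1::real} else {undefined})" for i
    have mem_I: "y \<in> I i \<longleftrightarrow> (i < N \<longrightarrow> y \<in> {-1..1}) \<and> (\<not> i < N \<longrightarrow> y = undefined)" for y i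
      unfolding I_def by simp
    have "compactin euclidean (I i)" for i
      unfolding I_def by (simp add: compactin_euclidean_iff)
    then have "compactin (product_topology (\<lambda>_. euclidean) UNIV) (PiE UNIV I)"
      unfolding compactin_PiE by blast
    moreover have "PiE UNIV I = PiE {..<N} (\<lambda>_. {-1..1::real})"
    proof (rule Set.set_eqI)
      fix f :: "nat \<Rightarrow> real"
      show "f \<in> PiE UNIV I \<longleftrightarrow> f \<in> PiE {..<N} (\<lambda>_. {-1..1::real})"
        unfolding PiE_UNIV_domain Pi_iff PiE_iff extensional_def Ball_def mem_Collect_eq UNIV_I simp_thms mem_I lessThan_iff
        by blast
    qed
    ultimately show ?thesis
      by (simp only: euclidean_product_topology compactin_euclidean_iff)
  qed
  have coord: "continuous_on T (\<lambda>f :: nat \<Rightarrow> real. f i)" for i T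
    by (rule continuous_on_subset[OF continuous_on_product_coordinates]) simp
  have "closed {f :: nat \<Rightarrow> real. (\<Sum>i<N. (f i)\<^sup>2) = 1}"
    by (intro closed_Collect_eq continuous_intros coord)
  with box have S: "compact S" unfolding S_def by (rule compact_Int_closed)
  have nz: "vec N f \<noteq> 0\<^sub>v N" if "f \<in> S" for f
  proof
    assume "vec N f = 0\<^sub>v N"
    then have "f i = 0" if "i < N" for i using that by (metis index_vec index_zero_vec(1))
    then show False using \<open>f \<in> S\<close> unfolding S_def by simp
  qed
  have cont: "continuous_on S (\<lambda>f. quad_form M (vec N f))" if "M \<in> carrier_mat N N" for M
    unfolding quad_form_as_sum[OF that] by (intro continuous_intros coord)
  have P1_pos: "quad_form P1 (vec N f) > 0" if "f \<in> S" for f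
    using pos_def_pos[OF P1 vec_carrier nz[OF that]] .
  have "continuous_on S g" unfolding g_def
    using P1_pos by (intro continuous_on_divide cont pos_def_carrier[OF P1] pos_def_carrier[OF P2] ballI)
      (simp add: less_imp_neq[symmetric])
  have normalised: "\<exists>f c. f \<in> S \<and> c > 0 \<and> x = c \<cdot>\<^sub>v vec N f" if x: "x \<in> carrier_vec N" "x \<noteq> 0\<^sub>v N" for x
  proof -
    define c where "c = sqrt (\<Sum>i<N. (x $ i)\<^sup>2)"
    define f where "f i = (if i < N then x $ i / c else undefined)" for i
    obtain k where k: "k < N" "x $ k \<noteq> 0" using x by (metis carrier_vecD eq_vecI index_zero_vec)
    have le: "(x $ i)\<^sup>2 \<le> (\<Sum>i<N. (x $ i)\<^sup>2)" if "i < N" for i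
      using that by (intro member_le_sum) auto
    have pos: "0 < (\<Sum>i<N. (x $ i)\<^sup>2)" using k(2) by (intro less_le_trans[OF _ le[OF k(1)]]) simp
    then have c: "c > 0" "c\<^sup>2 = (\<Sum>i<N. (x $ i)\<^sup>2)" unfolding c_def by auto
    have "\<bar>x $ i\<bar> \<le> c" if "i < N" for i
      unfolding c_def using le[OF that] by (metis real_sqrt_abs real_sqrt_le_iff)
    then have unit: "\<bar>x $ i / c\<bar> \<le> 1" if "i < N" for i
      using that c(1) by (simp add: abs_divide)
    have "x $ i / c \<in> {-1..1}" if "i < N" for i
      using abs_le_D1[OF unit[OF that]] abs_le_D2[OF unit[OF that]] unfolding atLeastAtMost_iff by linarith
    then have "f \<in> PiE {..<N} (\<lambda>_. {-1..1})"
      unfolding f_def by (simp add: PiE_iff extensional_def)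
    moreover have "(\<Sum>i<N. (f i)\<^sup>2) = (\<Sum>i<N. (x $ i)\<^sup>2 / c\<^sup>2)"
      unfolding f_def by (simp add: power_divide)
    then have "(\<Sum>i<N. (f i)\<^sup>2) = 1"
      using c pos by (simp flip: sum_divide_distrib)
    moreover have "x = c \<cdot>\<^sub>v vec N f" using x c unfolding f_def by (intro eq_vecI) auto
    ultimately show ?thesis using c(1) unfolding S_def by blast
  qed
  have "unit_vec N 0 \<in> carrier_vec N" "unit_vec N 0 \<noteq> (0\<^sub>v N :: real vec)"
    using N unit_vec_nonzero by auto
  then have "S \<noteq> {}" using normalised by blast
  then obtain f where f: "f \<in> S" "\<And>h. h \<in> S \<Longrightarrow> g h \<le> g f"
    using continuous_attains_sup[OF S _ \<open>continuous_on S g\<close>] by blast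
  show thesis
  proof (rule that[of "vec N f" "g f"])
    show "vec N f \<in> carrier_vec N" "vec N f \<noteq> 0\<^sub>v N" using nz f by auto
    show "quad_form P2 (vec N f) = g f * quad_form P1 (vec N f)"
      unfolding g_def using P1_pos[OF f(1)] by simp
    fix x :: "real vec" assume x: "x \<in> carrier_vec N"
    show "quad_form P2 x \<le> g f * quad_form P1 x"
    proof (cases "x = 0\<^sub>v N")
      case True
      then show ?thesis using quad_form_zero pos_def_carrier[OF P1] pos_def_carrier[OF P2] by auto
    next
      case False
      obtain h c where h: "h \<in> S" "c > 0" "x = c \<cdot>\<^sub>v vec N h" using normalised[OF x False] by blast
      have "quad_form P2 (vec N h) \<le> g f * quad_form P1 (vec N h)"
        using f(2)[OF h(1)] P1_pos[OF h(1)] unfolding g_def[of h] by (simp add: divide_simps)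
      then have "c\<^sup>2 * quad_form P2 (vec N h) \<le> c\<^sup>2 * (g f * quad_form P1 (vec N h))"
        by (intro mult_left_mono) auto
      then show ?thesis
        unfolding h(3) using pos_def_carrier[OF P1] pos_def_carrier[OF P2]
        by (simp add: quad_form_smult algebra_simps)
    qed
  qed
qed

lemma scalar_prod_self_real:
  fixes v :: "real vec"
  shows "v \<bullet> v \<ge> 0" and "v \<bullet> v = 0 \<Longrightarrow> v = 0\<^sub>v (dim_vec v)"
proof -
  show "v \<bullet> v \<ge> 0" unfolding scalar_prod_def by (intro sum_nonneg) simp
  assume "v \<bullet> v = 0"
  then have "\<forall>i \<in> {0..<dim_vec v}. v $ i * v $ i = 0"
    unfolding scalar_prod_def by (subst (asm) sum_nonneg_eq_0_iff) auto
  then show "v = 0\<^sub>v (dim_vec v)" by (intro eq_vecI) auto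
qed

lemma quad_form_psd_sqrt:
  assumes H: "is_psd_sqrt N H Q" and x: "x \<in> carrier_vec N"
  shows "quad_form Q x = (H *\<^sub>v x) \<bullet> (H *\<^sub>v x)"
proof -
  have Hc: "H \<in> carrier_mat N N" and "transpose_mat H = H" "Q = H * H"
    using H by (auto simp: is_psd_sqrt_def pos_semidef_def)
  then show ?thesis unfolding quad_form_def
    using x scalar_prod_mult_mat_vec[OF Hc x, of "H *\<^sub>v x"] by auto
qed

lemma pow_mat_Suc_left: "A \<in> carrier_mat k k \<Longrightarrow> A ^\<^sub>m Suc l = A * A ^\<^sub>m l"
proof (induction l)
  case (Suc l)
  then have "A ^\<^sub>m Suc (Suc l) = (A * A ^\<^sub>m l) * A" by simp
  also have "\<dots> = A * A ^\<^sub>m Suc l"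
    using assoc_mult_mat[OF Suc.prems pow_carrier_mat[OF Suc.prems, of l] Suc.prems] by simp
  finally show ?case .
qed simp

text \<open>
  The set of states at which \<open>V\<^sub>2 / V\<^sub>1\<close> attains its maximum \<open>t\<close> is invariant under \<open>A\<close> and has zero output
  as soon as \<open>t > 1\<close>, because the stage cost \<open>l\<close> of the control that is optimal for \<open>V\<^sub>1\<close> satisfies
  \<open>(t - 1) l \<le> 0\<close> there. Observability excludes such states, hence \<open>t \<le> 1\<close>.
\<close>

lemma bellman_solution_le:
  assumes A: "A \<in> carrier_mat N N" and B: "B \<in> carrier_mat N m"
    and R: "pos_def m R" and P1: "pos_def N P1" and P2: "pos_def N P2"
    and H: "is_psd_sqrt N H Q" and obs: "observable A H"
    and bell1: "solves_bellman A B Q R P1" and bell2: "solves_bellman A B Q R P2"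
    and z: "z \<in> carrier_vec N"
  shows "quad_form P2 z \<le> quad_form P1 z"
proof (rule ccontr)
  assume gt: "\<not> quad_form P2 z \<le> quad_form P1 z"
  then have "z \<noteq> 0\<^sub>v N" using quad_form_zero pos_def_carrier[OF P1] pos_def_carrier[OF P2] by auto
  with z have "N > 0" by (cases N) auto
  obtain t y where y: "y \<in> carrier_vec N" "y \<noteq> 0\<^sub>v N" "quad_form P2 y = t * quad_form P1 y"
    and t: "\<And>x. x \<in> carrier_vec N \<Longrightarrow> quad_form P2 x \<le> t * quad_form P1 x"
    using max_quad_form_ratio[OF P1 P2 \<open>N > 0\<close>] by blast
  have "t > 1"
  proof (rule ccontr)
    assume "\<not> t > 1"
    then have "t * quad_form P1 z \<le> 1 * quad_form P1 z"
      using pos_def_nonneg[OF P1 z] by (intro mult_right_mono) auto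
    with t[OF z] gt show False by simp
  qed
  have Hc: "H \<in> carrier_mat N N"
    using H by (auto simp: is_psd_sqrt_def pos_semidef_def)
  have step: "H *\<^sub>v x = 0\<^sub>v N \<and> quad_form P2 (A *\<^sub>v x) = t * quad_form P1 (A *\<^sub>v x)"
    if x: "x \<in> carrier_vec N" and max: "quad_form P2 x = t * quad_form P1 x" for x
  proof -
    obtain u where u: "u \<in> carrier_vec m"
      and eq: "quad_form P1 x = quad_form Q x + quad_form R u + quad_form P1 (A *\<^sub>v x + B *\<^sub>v u)"
      using bell1 x A B unfolding solves_bellman_def by auto
    let ?y = "A *\<^sub>v x + B *\<^sub>v u"
    have yc: "?y \<in> carrier_vec N" using A B x u by auto
    have Q0: "quad_form Q x \<ge> 0" unfolding quad_form_psd_sqrt[OF H x] by (rule scalar_prod_self_real)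
    have R0: "quad_form R u \<ge> 0" by (rule pos_def_nonneg[OF R u])
    have le: "quad_form P2 x \<le> quad_form Q x + quad_form R u + quad_form P2 ?y"
      using bell2 x u A B unfolding solves_bellman_def by auto
    let ?l = "quad_form Q x + quad_form R u"
    have "t * (?l + quad_form P1 ?y) \<le> ?l + t * quad_form P1 ?y"
      using le t[OF yc] max eq by simp
    then have "(t - 1) * ?l \<le> 0" by (simp add: algebra_simps)
    with \<open>t > 1\<close> have "?l \<le> 0" by (simp add: mult_le_0_iff)
    with Q0 R0 have zero: "quad_form Q x = 0" "quad_form R u = 0" by auto
    then have "u = 0\<^sub>v m" using pos_def_zero_iff[OF R u] by simp
    then have "?y = A *\<^sub>v x" using A B x by auto
    moreover have "H *\<^sub>v x = 0\<^sub>v N"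
      using zero(1) Hc scalar_prod_self_real(2)[of "H *\<^sub>v x"] unfolding quad_form_psd_sqrt[OF H x] by simp
    moreover have "quad_form P2 ?y = t * quad_form P1 ?y"
      using le t[OF yc] max eq zero by simp
    ultimately show ?thesis by simp
  qed
  have pow: "(A ^\<^sub>m k) *\<^sub>v y \<in> carrier_vec N" for k
    using pow_carrier_mat[OF A] y(1) by (rule mult_mat_vec_carrier)
  have "quad_form P2 ((A ^\<^sub>m k) *\<^sub>v y) = t * quad_form P1 ((A ^\<^sub>m k) *\<^sub>v y)" for k
  proof (induction k)
    case 0
    then show ?case using y A by simp
  next
    case (Suc k)
    have "A ^\<^sub>m Suc k = A * A ^\<^sub>m k" using A by (rule pow_mat_Suc_left)
    then have "(A ^\<^sub>m Suc k) *\<^sub>v y = A *\<^sub>v ((A ^\<^sub>m k) *\<^sub>v y)"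
      using A y by (metis assoc_mult_mat_vec pow_carrier_mat)
    with step[OF pow Suc] show ?case by simp
  qed
  then have "H *\<^sub>v ((A ^\<^sub>m k) *\<^sub>v y) = 0\<^sub>v N" for k using step[OF pow] by blast
  moreover have "H *\<^sub>v ((A ^\<^sub>m k) *\<^sub>v 0\<^sub>v N) = 0\<^sub>v N" for k
    using mult_mat_zero_vec[OF pow_carrier_mat[OF A]] mult_mat_zero_vec[OF Hc] by simp
  ultimately have "y = 0\<^sub>v N"
    using obs y(1) A unfolding observable_def by (metis carrier_matD(1) zero_carrier_vec)
  with y(2) show False ..
qed

lemma sym_mat_eq_by_quad_form:
  assumes M: "M \<in> carrier_mat k k" "transpose_mat M = M" and L: "L \<in> carrier_mat k k" "transpose_mat L = L"
    and eq: "\<And>x. x \<in> carrier_vec k \<Longrightarrow> quad_form M x = quad_form L x"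
  shows "M = L"
proof (rule eq_matI)
  fix i j assume "i < dim_row L" "j < dim_col L"
  then have ij: "i < k" "j < k" using L by auto
  have e: "unit_vec k i \<in> carrier_vec k" "unit_vec k j \<in> carrier_vec k" by auto
  have entry: "unit_vec k i \<bullet> (W *\<^sub>v unit_vec k j) = W $$ (i,j)" if "W \<in> carrier_mat k k" for W :: "real mat"
    using that ij by (simp add: row_def)
  have "unit_vec k i \<bullet> (M *\<^sub>v unit_vec k j) = unit_vec k i \<bullet> (L *\<^sub>v unit_vec k j)"
    using quad_form_add[OF M e] quad_form_add[OF L e] eq[OF e(1)] eq[OF e(2)]
      eq[of "unit_vec k i + unit_vec k j"] by simp
  then show "M $$ (i,j) = L $$ (i,j)" using entry M L by simp
qed (use M L in auto)

text \<open>
  The two quadratic forms bound each other, so they are equal, and by polarisation a symmetric matrix is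
  determined by its form.
\<close>

lemma bellman_solution_unique:
  assumes "A \<in> carrier_mat N N" and "B \<in> carrier_mat N m"
    and "pos_def m R" and P1: "pos_def N P1" and P2: "pos_def N P2"
    and "is_psd_sqrt N H Q" and "observable A H"
    and "solves_bellman A B Q R P1" and "solves_bellman A B Q R P2"
  shows "P1 = P2"
  using assms
  by (intro sym_mat_eq_by_quad_form[OF pos_def_carrier[OF P1] pos_def_sym[OF P1]
        pos_def_carrier[OF P2] pos_def_sym[OF P2]] antisym)
    (blast intro: bellman_solution_le)+

section \<open>The cyclic block shift\<close>

lemma div_less_of_less_mult: "(i :: nat) < n * m \<Longrightarrow> i div m < n \<and> i mod m < m \<and> m > 0"
  by (cases "m = 0") (auto simp: less_mult_imp_div_less)

lemma block_index_less: "(k :: nat) < n \<Longrightarrow> r < m \<Longrightarrow> k * m + r < n * m"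
proof -
  assume "k < n" "r < m"
  then have "k * m + r < Suc k * m" by simp
  also have "\<dots> \<le> n * m" using \<open>k < n\<close> by (intro mult_right_mono) auto
  finally show ?thesis .
qed

lemma sum_blocks: "(\<Sum>k<n * m. f k) = (\<Sum>q<n. \<Sum>t<m. f (q * m + t :: nat))"
proof -
  have "(\<Sum>k = q * m..<q * m + m. f k) = (\<Sum>t<m. f (q * m + t))" for q
    using sum.shift_bounds_nat_ivl[of f 0 "q * m" m] by (simp add: add.commute lessThan_atLeast0)
  then show ?thesis by (simp flip: sum.nat_group)
qed

text \<open>
  The permutation \<open>\<sigma>\<close> of the indices below \<open>n * m\<close> that cycles the \<open>n\<close> blocks of length \<open>m\<close>.
\<close>

definition block_shift :: "nat \<Rightarrow> nat \<Rightarrow> nat \<Rightarrow> nat" where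
  "block_shift n m i = (Suc (i div m) mod n) * m + i mod m"

lemma block_shift_div_mod:
  assumes "i < n * m"
  shows "block_shift n m i div m = Suc (i div m) mod n" "block_shift n m i mod m = i mod m"
  using div_less_of_less_mult[OF assms] by (auto simp: block_shift_def)

lemma Suc_mod_inj: "a < n \<Longrightarrow> b < n \<Longrightarrow> Suc a mod n = Suc b mod n \<Longrightarrow> a = b"
  by (cases "Suc a = n"; cases "Suc b = n") auto

lemma bij_betw_block_shift: "bij_betw (block_shift n m) {..<n * m} {..<n * m}"
proof -
  have "inj_on (block_shift n m) {..<n * m}"
  proof (rule inj_onI)
    fix i j assume "i \<in> {..<n * m}" "j \<in> {..<n * m}" and eq: "block_shift n m i = block_shift n m j"
    then have ij: "i < n * m" "j < n * m" by auto
    have "i div m = j div m"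
      using div_less_of_less_mult[OF ij(1)] div_less_of_less_mult[OF ij(2)]
        block_shift_div_mod(1)[OF ij(1)] block_shift_div_mod(1)[OF ij(2)] eq Suc_mod_inj by metis
    moreover have "i mod m = j mod m"
      using block_shift_div_mod(2)[OF ij(1)] block_shift_div_mod(2)[OF ij(2)] eq by metis
    ultimately show "i = j" by (metis div_mult_mod_eq)
  qed
  moreover have "block_shift n m ` {..<n * m} \<subseteq> {..<n * m}"
  proof (intro image_subsetI)
    fix i assume "i \<in> {..<n * m}"
    then have "i div m < n" "i mod m < m" using div_less_of_less_mult[of i n m] by auto
    then show "block_shift n m i \<in> {..<n * m}"
      unfolding block_shift_def by (auto intro: block_index_less)
  qed
  ultimately show ?thesis
    unfolding bij_betw_def using endo_inj_surj[of "{..<n * m}"] by blast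
qed

lemma block_shift_less: "i < n * m \<Longrightarrow> block_shift n m i < n * m"
  using bij_betwE[OF bij_betw_block_shift] by blast

lemma sum_block_shift: "(\<Sum>i<n * m. f (block_shift n m i)) = (\<Sum>i<n * m. f i)"
  by (rule sum.reindex_bij_betw[OF bij_betw_block_shift])

definition shift_invariant :: "nat \<Rightarrow> nat \<Rightarrow> nat \<Rightarrow> 'a mat \<Rightarrow> bool" where
  "shift_invariant n a b M \<longleftrightarrow> M \<in> carrier_mat (n * a) (n * b) \<and>
     (\<forall>i < n * a. \<forall>j < n * b. M $$ (block_shift n a i, block_shift n b j) = M $$ (i, j))"

lemma shift_difference_mod:
  assumes "(r :: nat) < n" "s < n"
  shows "(Suc s mod n + n - Suc r mod n) mod n = (s + n - r) mod n"
proof -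
  consider "Suc r = n" "Suc s = n" | "Suc r = n" "Suc s < n" | "Suc r < n" "Suc s = n" | "Suc r < n" "Suc s < n"
    using assms by linarith
  then show ?thesis
  proof cases
    case 1
    then have "r = s" by simp
    with 1 show ?thesis by simp
  next
    case 2
    then have "Suc s mod n + n - Suc r mod n = Suc s + n" by simp
    moreover have "s + n - r = Suc s" using 2 by linarith
    ultimately show ?thesis by (simp only: mod_add_self2)
  next
    case 3
    then have "Suc s mod n + n - Suc r mod n = n - Suc r" by simp
    moreover have "s + n - r = (n - Suc r) + n" using 3 by linarith
    ultimately show ?thesis by (simp only: mod_add_self2)
  next
    case 4
    then have "Suc s mod n + n - Suc r mod n = s + n - r" by simp
    then show ?thesis by (simp only:)
  qed
qed

lemma block_circulant_shift_invariant:
  assumes "M \<in> block_circulant n a b"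
  shows "shift_invariant n a b M"
proof -
  from assms obtain c where M: "M \<in> carrier_mat (n * a) (n * b)" and
    c: "\<And>r s. r < n \<Longrightarrow> s < n \<Longrightarrow> block_of a b M r s = c ((s + n - r) mod n)"
    unfolding block_circulant_def by auto
  have entry: "M $$ (i, j) = c ((j div b + n - i div a) mod n) $$ (i mod a, j mod b)"
    if ij: "i < n * a" "j < n * b" for i j
  proof -
    note d = div_less_of_less_mult[OF ij(1)] div_less_of_less_mult[OF ij(2)]
    then have "block_of a b M (i div a) (j div b) $$ (i mod a, j mod b) = M $$ (i, j)"
      unfolding block_of_def by simp
    with c d show ?thesis by simp
  qed
  show ?thesis unfolding shift_invariant_def
    using M div_less_of_less_mult
    by (auto simp: entry block_shift_less block_shift_div_mod shift_difference_mod)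
qed

section \<open>Shift invariance of the Riccati solution\<close>

definition vec_shift :: "nat \<Rightarrow> nat \<Rightarrow> 'a vec \<Rightarrow> 'a vec" where
  "vec_shift n m x = vec (n * m) (\<lambda>i. x $ block_shift n m i)"

text \<open>
  For \<open>a = b\<close> this is the congruence of \<open>M\<close> by the permutation matrix of the block shift.
\<close>

definition mat_shift :: "nat \<Rightarrow> nat \<Rightarrow> nat \<Rightarrow> 'a mat \<Rightarrow> 'a mat" where
  "mat_shift n a b M =
     mat (n * a) (n * b) (\<lambda>(i, j). M $$ (block_shift n a i, block_shift n b j))"

lemma vec_shift_carrier: "vec_shift n m x \<in> carrier_vec (n * m)"
  by (simp add: vec_shift_def)

lemma mat_shift_carrier: "mat_shift n a b M \<in> carrier_mat (n * a) (n * b)"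
  by (simp add: mat_shift_def)

lemma shift_invariant_iff_mat_shift:
  "shift_invariant n a b M \<longleftrightarrow> M \<in> carrier_mat (n * a) (n * b) \<and> mat_shift n a b M = M"
  unfolding shift_invariant_def mat_shift_def by (auto simp: mat_eq_iff)

lemma vec_shift_add:
  "x \<in> carrier_vec (n * m) \<Longrightarrow> y \<in> carrier_vec (n * m) \<Longrightarrow>
   vec_shift n m (x + y) = vec_shift n m x + vec_shift n m y"
  unfolding vec_shift_def by (intro eq_vecI) (auto simp: block_shift_less)

lemma vec_shift_surj:
  assumes "y \<in> carrier_vec (n * m)"
  obtains x where "x \<in> carrier_vec (n * m)" "y = vec_shift n m x"
proof (rule that)
  let ?x = "vec (n * m) (\<lambda>i. y $ inv_into {..<n * m} (block_shift n m) i)"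
  show "?x \<in> carrier_vec (n * m)" by simp
  have "inv_into {..<n * m} (block_shift n m) (block_shift n m i) = i" if "i < n * m" for i
    using that bij_betw_imp_inj_on[OF bij_betw_block_shift] by (intro inv_into_f_f) auto
  then show "y = vec_shift n m ?x"
    using assms unfolding vec_shift_def by (intro eq_vecI) (auto simp: block_shift_less)
qed

lemma scalar_prod_vec_shift:
  assumes "x \<in> carrier_vec (n * m)" "y \<in> carrier_vec (n * m)"
  shows "vec_shift n m x \<bullet> vec_shift n m y = x \<bullet> y"
  using assms sum_block_shift[of "\<lambda>i. x $ i * y $ i" n m]
  by (simp add: scalar_prod_def vec_shift_def lessThan_atLeast0)

lemma mat_shift_mult_vec_shift:
  assumes M: "M \<in> carrier_mat (n * a) (n * b)" and x: "x \<in> carrier_vec (n * b)"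
  shows "mat_shift n a b M *\<^sub>v vec_shift n b x = vec_shift n a (M *\<^sub>v x)"
proof (rule eq_vecI)
  fix i assume "i < dim_vec (vec_shift n a (M *\<^sub>v x))"
  then have i: "i < n * a" by (simp add: vec_shift_def)
  have "(mat_shift n a b M *\<^sub>v vec_shift n b x) $ i
    = (\<Sum>j<n * b. M $$ (block_shift n a i, block_shift n b j) * x $ block_shift n b j)"
    using i by (simp add: mat_shift_def vec_shift_def scalar_prod_def lessThan_atLeast0)
  also have "\<dots> = (\<Sum>j<n * b. M $$ (block_shift n a i, j) * x $ j)"
    by (rule sum_block_shift)
  also have "\<dots> = vec_shift n a (M *\<^sub>v x) $ i"
    using i M x block_shift_less[OF i] by (simp add: vec_shift_def scalar_prod_def lessThan_atLeast0)
  finally show "(mat_shift n a b M *\<^sub>v vec_shift n b x) $ i = vec_shift n a (M *\<^sub>v x) $ i" .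
qed (simp add: vec_shift_def mat_shift_def)

lemma shift_invariant_mult_vec_shift:
  "shift_invariant n a b M \<Longrightarrow> x \<in> carrier_vec (n * b) \<Longrightarrow>
   M *\<^sub>v vec_shift n b x = vec_shift n a (M *\<^sub>v x)"
  using mat_shift_mult_vec_shift[of M n a b x] by (simp add: shift_invariant_iff_mat_shift)

lemma quad_form_mat_shift:
  assumes M: "M \<in> carrier_mat (n * m) (n * m)" and x: "x \<in> carrier_vec (n * m)"
  shows "quad_form (mat_shift n m m M) (vec_shift n m x) = quad_form M x"
  unfolding quad_form_def mat_shift_mult_vec_shift[OF M x]
  using M x by (intro scalar_prod_vec_shift) auto

lemma quad_form_vec_shift:
  "shift_invariant n m m M \<Longrightarrow> x \<in> carrier_vec (n * m) \<Longrightarrow>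
   quad_form M (vec_shift n m x) = quad_form M x"
  using quad_form_mat_shift[of M n m x] by (simp add: shift_invariant_iff_mat_shift)

lemma pos_def_mat_shift:
  assumes P: "pos_def (n * m) P"
  shows "pos_def (n * m) (mat_shift n m m P)"
  unfolding pos_def_def
proof (intro conjI ballI impI)
  note Pc = pos_def_carrier[OF P]
  show "mat_shift n m m P \<in> carrier_mat (n * m) (n * m)" by (rule mat_shift_carrier)
  have "P $$ (j, i) = P $$ (i, j)" if "i < n * m" "j < n * m" for i j
    using that Pc arg_cong[OF pos_def_sym[OF P], of "\<lambda>M. M $$ (i, j)"] by simp
  then show "transpose_mat (mat_shift n m m P) = mat_shift n m m P"
    unfolding mat_shift_def by (intro eq_matI) (auto simp: block_shift_less)
  fix v :: "real vec" assume v: "v \<in> carrier_vec (n * m)" "v \<noteq> 0\<^sub>v (n * m)"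
  obtain x where x: "x \<in> carrier_vec (n * m)" "v = vec_shift n m x"
    using vec_shift_surj[OF v(1)] by blast
  have "x \<noteq> 0\<^sub>v (n * m)"
  proof
    assume "x = 0\<^sub>v (n * m)"
    then have "v = 0\<^sub>v (n * m)"
      unfolding x(2) vec_shift_def by (intro eq_vecI) (auto simp: block_shift_less)
    with v(2) show False ..
  qed
  then have "quad_form (mat_shift n m m P) v > 0"
    unfolding x(2) quad_form_mat_shift[OF Pc x(1)] using pos_def_pos[OF P x(1)] by blast
  then show "v \<bullet> (mat_shift n m m P *\<^sub>v v) > 0" by (simp add: quad_form_def)
qed

text \<open>
  Every state and every input is the shift of another one (\<open>vec_shift_surj\<close>). Since the dynamics
  commute with the shift and the stage cost is unchanged by it, the Bellman equation of the shifted matrix at shifted arguments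
  is the Bellman equation of the original matrix.
\<close>

lemma solves_bellman_mat_shift:
  assumes A: "shift_invariant n nx nx A" and B: "shift_invariant n nx nu B"
    and Q: "shift_invariant n nx nx Q" and R: "shift_invariant n nu nu R"
    and P: "P \<in> carrier_mat (n * nx) (n * nx)" and bell: "solves_bellman A B Q R P"
  shows "solves_bellman A B Q R (mat_shift n nx nx P)"
proof -
  have Ac: "A \<in> carrier_mat (n * nx) (n * nx)" and Bc: "B \<in> carrier_mat (n * nx) (n * nu)"
    using A B by (auto simp: shift_invariant_def)
  let ?P = "mat_shift n nx nx P"
  have cost: "quad_form Q (vec_shift n nx x) + quad_form R (vec_shift n nu u)
        + quad_form ?P (A *\<^sub>v vec_shift n nx x + B *\<^sub>v vec_shift n nu u)
      = quad_form Q x + quad_form R u + quad_form P (A *\<^sub>v x + B *\<^sub>v u)"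
    if x: "x \<in> carrier_vec (n * nx)" and u: "u \<in> carrier_vec (n * nu)" for x u
  proof -
    have c: "A *\<^sub>v x \<in> carrier_vec (n * nx)" "B *\<^sub>v u \<in> carrier_vec (n * nx)"
      "A *\<^sub>v x + B *\<^sub>v u \<in> carrier_vec (n * nx)" using Ac Bc x u by auto
    show ?thesis
      unfolding shift_invariant_mult_vec_shift[OF A x] shift_invariant_mult_vec_shift[OF B u]
        vec_shift_add[OF c(1,2), symmetric] quad_form_mat_shift[OF P c(3)]
        quad_form_vec_shift[OF Q x] quad_form_vec_shift[OF R u] ..
  qed
  have bellP: "\<forall>u \<in> carrier_vec (n * nu).
      quad_form P x \<le> quad_form Q x + quad_form R u + quad_form P (A *\<^sub>v x + B *\<^sub>v u)"
    "\<exists>u \<in> carrier_vec (n * nu).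
      quad_form P x = quad_form Q x + quad_form R u + quad_form P (A *\<^sub>v x + B *\<^sub>v u)"
    if "x \<in> carrier_vec (n * nx)" for x
    using bell that Ac Bc unfolding solves_bellman_def by auto
  show ?thesis unfolding solves_bellman_def
  proof (intro ballI conjI)
    fix y v :: "real vec" assume "y \<in> carrier_vec (dim_row A)" "v \<in> carrier_vec (dim_col B)"
    then have "y \<in> carrier_vec (n * nx)" "v \<in> carrier_vec (n * nu)" using Ac Bc by auto
    then obtain x u where x: "x \<in> carrier_vec (n * nx)" "y = vec_shift n nx x"
      and u: "u \<in> carrier_vec (n * nu)" "v = vec_shift n nu u"
      by (meson vec_shift_surj)
    show "quad_form ?P y \<le> quad_form Q y + quad_form R v + quad_form ?P (A *\<^sub>v y + B *\<^sub>v v)"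
      unfolding x(2) u(2) cost[OF x(1) u(1)] quad_form_mat_shift[OF P x(1)]
      using bellP(1)[OF x(1)] u(1) by blast
  next
    fix y :: "real vec" assume "y \<in> carrier_vec (dim_row A)"
    then obtain x where x: "x \<in> carrier_vec (n * nx)" "y = vec_shift n nx x"
      using Ac by (metis carrier_matD(1) vec_shift_surj)
    obtain u where u: "u \<in> carrier_vec (n * nu)"
      "quad_form P x = quad_form Q x + quad_form R u + quad_form P (A *\<^sub>v x + B *\<^sub>v u)"
      using bellP(2)[OF x(1)] by blast
    have "vec_shift n nu u \<in> carrier_vec (dim_col B)" using Bc vec_shift_carrier by auto
    moreover have "quad_form ?P y = quad_form Q y + quad_form R (vec_shift n nu u)
        + quad_form ?P (A *\<^sub>v y + B *\<^sub>v vec_shift n nu u)"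
      unfolding x(2) cost[OF x(1) u(1)] quad_form_mat_shift[OF P x(1)] by (rule u(2))
    ultimately show "\<exists>v \<in> carrier_vec (dim_col B).
        quad_form ?P y = quad_form Q y + quad_form R v + quad_form ?P (A *\<^sub>v y + B *\<^sub>v v)" by blast
  qed
qed

text \<open>
  A positive definite solution and its shift solve the same Bellman equation, so they coincide.
\<close>

lemma dare_solution_shift_invariant:
  assumes A: "shift_invariant n nx nx A" and B: "shift_invariant n nx nu B"
    and Q: "shift_invariant n nx nx Q" and R: "shift_invariant n nu nu R"
    and R_pos: "pos_def (n * nu) R" and P: "pos_def (n * nx) P"
    and H: "is_psd_sqrt (n * nx) H Q" and obs: "observable A H" and dare: "solves_dare A B Q R P"
  shows "shift_invariant n nx nx P"
proof -
  have c: "A \<in> carrier_mat (n * nx) (n * nx)" "B \<in> carrier_mat (n * nx) (n * nu)"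
    "Q \<in> carrier_mat (n * nx) (n * nx)"
    using A B Q by (auto simp: shift_invariant_def)
  note bell = solves_dare_imp_solves_bellman[OF c R_pos P dare]
  have "mat_shift n nx nx P = P"
    by (rule bellman_solution_unique[OF c(1,2) R_pos pos_def_mat_shift[OF P] P H obs
          solves_bellman_mat_shift[OF A B Q R pos_def_carrier[OF P] bell] bell])
  then show ?thesis using pos_def_carrier[OF P] by (simp add: shift_invariant_iff_mat_shift)
qed

section \<open>Block diagonalisation by Fourier matrices\<close>

definition unit_root :: "nat \<Rightarrow> nat \<Rightarrow> complex" where
  "unit_root n j = exp (2 * complex_of_real pi * \<i> * of_nat j / of_nat n)"

lemma unit_root_cis: "unit_root n k = cis (2 * pi * real k / real n)"
  by (simp add: unit_root_def cis_conv_exp mult_ac)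

lemma unit_root_power: "n > 0 \<Longrightarrow> unit_root n j ^ n = 1"
proof -
  assume "n > 0"
  have "unit_root n j ^ n = exp (of_nat n * (2 * complex_of_real pi * \<i> * of_nat j / of_nat n))"
    unfolding unit_root_def by (rule exp_of_nat_mult[symmetric])
  also have "of_nat n * (2 * complex_of_real pi * \<i> * of_nat j / of_nat n) = of_nat j * (2 * of_real pi * \<i>)"
    using \<open>n > 0\<close> by simp
  also have "exp \<dots> = 1" by (simp add: exp_of_nat_mult)
  finally show ?thesis .
qed

lemma cnj_unit_root_mult: "cnj (unit_root n j) * unit_root n j = 1"
  by (simp add: unit_root_cis cis_cnj cis_mult)

lemma unit_root_inj:
  assumes "i < n" "j < n" "unit_root n i = unit_root n j"
  shows "i = j"
proof -
  have "inj_on (\<lambda>k. cis (2 * pi * real k / real n)) {..<n}"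
    using bij_betw_roots_unity[of n] assms(1) by (auto simp: bij_betw_def)
  then show ?thesis
    using assms(3) unfolding unit_root_cis by (rule inj_onD) (use assms in simp_all)
qed

definition block_fourier :: "nat \<Rightarrow> nat \<Rightarrow> complex mat" where
  "block_fourier n m = fourier_mat n \<otimes>\<^sub>K 1\<^sub>m m"

lemma block_fourier_carrier: "block_fourier n m \<in> carrier_mat (n * m) (n * m)"
  unfolding block_fourier_def kronecker_def fourier_mat_def by auto

lemma block_fourier_index:
  assumes "i < n * m" "j < n * m"
  shows "block_fourier n m $$ (i, j)
    = 1 / complex_of_real (sqrt (real n)) * unit_root n (j div m) ^ (i div m) * (if i mod m = j mod m then 1 else 0)"
  using assms div_less_of_less_mult[OF assms(1)] div_less_of_less_mult[OF assms(2)]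
  unfolding block_fourier_def kronecker_def fourier_mat_def unit_root_def by simp

text \<open>
  The columns of the Fourier matrix are eigenvectors of the block shift: moving to the next block
  multiplies column \<open>j\<close> by the root of unity that generates it. The wrap-around from the last block to
  the first is harmless because this root has order dividing \<open>n\<close>.
\<close>

lemma block_fourier_shift:
  assumes "i < n * m" "j < n * m"
  shows "block_fourier n m $$ (block_shift n m i, j) = unit_root n (j div m) * block_fourier n m $$ (i, j)"
proof -
  have n: "n > 0" using assms(1) by (cases n) auto
  have "unit_root n k ^ (Suc l mod n) = unit_root n k ^ Suc l" if "l < n" for k l
    using that unit_root_power[OF n, of k] by (cases "Suc l = n") auto
  with div_less_of_less_mult[OF assms(1)]
  have "unit_root n (j div m) ^ (Suc (i div m) mod n) = unit_root n (j div m) ^ Suc (i div m)" by blast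
  then show ?thesis
    using assms by (simp add: block_fourier_index block_shift_less block_shift_div_mod)
qed

lemma mat_adjoint_carrier: "M \<in> carrier_mat a b \<Longrightarrow> mat_adjoint M \<in> carrier_mat b a"
  unfolding mat_adjoint_def by auto

lemma mat_adjoint_index:
  fixes M :: "complex mat"
  assumes "M \<in> carrier_mat a b" "i < b" "j < a"
  shows "mat_adjoint M $$ (i, j) = cnj (M $$ (j, i))"
  using assms unfolding mat_adjoint_def by (simp add: mat_of_rows_index)

definition fourier_transform :: "nat \<Rightarrow> nat \<Rightarrow> nat \<Rightarrow> real mat \<Rightarrow> complex mat" where
  "fourier_transform n a b M =
     mat_adjoint (block_fourier n a) * map_mat complex_of_real M * block_fourier n b"

lemma fourier_transform_carrier:
  "M \<in> carrier_mat (n * a) (n * b) \<Longrightarrow> fourier_transform n a b M \<in> carrier_mat (n * a) (n * b)"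
  unfolding fourier_transform_def
  using mat_adjoint_carrier[OF block_fourier_carrier[of n a]] block_fourier_carrier[of n b] by auto

lemma index_mult_mat_sum:
  assumes "X \<in> carrier_mat a b" "Y \<in> carrier_mat b c" "i < a" "j < c"
  shows "(X * Y) $$ (i, j) = (\<Sum>k<b. X $$ (i, k) * Y $$ (k, j))"
  using assms by (auto simp: scalar_prod_def lessThan_atLeast0)

lemma fourier_transform_index:
  assumes M: "M \<in> carrier_mat (n * a) (n * b)" and ij: "i < n * a" "j < n * b"
  shows "fourier_transform n a b M $$ (i, j) =
    (\<Sum>l<n * b. \<Sum>k<n * a. cnj (block_fourier n a $$ (k, i)) * of_real (M $$ (k, l)) * block_fourier n b $$ (l, j))"
proof -
  note F = mat_adjoint_carrier[OF block_fourier_carrier[of n a]]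
  have Mc: "map_mat complex_of_real M \<in> carrier_mat (n * a) (n * b)" using M by auto
  have "fourier_transform n a b M $$ (i, j) =
    (\<Sum>l<n * b. (mat_adjoint (block_fourier n a) * map_mat complex_of_real M) $$ (i, l) * block_fourier n b $$ (l, j))"
    unfolding fourier_transform_def
    by (rule index_mult_mat_sum[OF mult_carrier_mat[OF F Mc] block_fourier_carrier ij])
  also have "\<dots> = (\<Sum>l<n * b. \<Sum>k<n * a. cnj (block_fourier n a $$ (k, i)) * of_real (M $$ (k, l)) * block_fourier n b $$ (l, j))"
  proof (intro sum.cong refl)
    fix l assume "l \<in> {..<n * b}"
    then have l: "l < n * b" by simp
    have "(mat_adjoint (block_fourier n a) * map_mat complex_of_real M) $$ (i, l)
      = (\<Sum>k<n * a. cnj (block_fourier n a $$ (k, i)) * of_real (M $$ (k, l)))"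
      unfolding index_mult_mat_sum[OF F Mc ij(1) l]
      using M l ij by (intro sum.cong) (auto simp: mat_adjoint_index[OF block_fourier_carrier])
    then show "(mat_adjoint (block_fourier n a) * map_mat complex_of_real M) $$ (i, l) * block_fourier n b $$ (l, j)
      = (\<Sum>k<n * a. cnj (block_fourier n a $$ (k, i)) * of_real (M $$ (k, l)) * block_fourier n b $$ (l, j))"
      by (simp add: sum_distrib_right)
  qed
  finally show ?thesis .
qed

text \<open>
  Applying the shift to both summation indices leaves the entry of \<open>M\<close> unchanged and multiplies the
  two Fourier factors by their eigenvalues. So the entry \<open>X\<close> of the transform satisfies \<open>X = w X\<close>, where
  \<open>w\<close> is the quotient of two \<open>n\<close>-th roots of unity, which differ if the blocks do.
\<close>

lemma fourier_transform_off_diagonal: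
  assumes M: "shift_invariant n a b M" and ij: "i < n * a" "j < n * b" and off: "i div a \<noteq> j div b"
  shows "fourier_transform n a b M $$ (i, j) = 0"
proof -
  have Mc: "M \<in> carrier_mat (n * a) (n * b)" using M by (simp add: shift_invariant_def)
  let ?w = "cnj (unit_root n (i div a)) * unit_root n (j div b)"
  let ?f = "\<lambda>k l. cnj (block_fourier n a $$ (k, i)) * of_real (M $$ (k, l)) * block_fourier n b $$ (l, j)"
  have "fourier_transform n a b M $$ (i, j) = (\<Sum>l<n * b. \<Sum>k<n * a. ?f k l)"
    by (rule fourier_transform_index[OF Mc ij])
  also have "\<dots> = (\<Sum>l<n * b. \<Sum>k<n * a. ?f (block_shift n a k) (block_shift n b l))"
    by (simp only: sum_block_shift[of "\<lambda>k. ?f k _" n a]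
        sum_block_shift[of "\<lambda>l. \<Sum>k<n * a. ?f k l" n b])
  also have "\<dots> = (\<Sum>l<n * b. \<Sum>k<n * a. ?w * ?f k l)"
    using M ij by (intro sum.cong refl) (simp add: shift_invariant_def block_fourier_shift)
  also have "\<dots> = ?w * fourier_transform n a b M $$ (i, j)"
    unfolding fourier_transform_index[OF Mc ij] by (simp add: sum_distrib_left)
  finally have "fourier_transform n a b M $$ (i, j) = 0 \<or> ?w = 1" by simp
  moreover have "?w \<noteq> 1"
  proof
    assume "?w = 1"
    then have "unit_root n (j div b) = unit_root n (i div a)"
      using cnj_unit_root_mult[of n "i div a"]
      by (metis mult.commute mult.left_commute mult.right_neutral)
    with unit_root_inj div_less_of_less_mult[OF ij(1)] div_less_of_less_mult[OF ij(2)] off show False by metis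
  qed
  ultimately show ?thesis by blast
qed

lemma diag_block_mat_carrier:
  assumes "\<And>M. M \<in> set Ms \<Longrightarrow> M \<in> carrier_mat a b"
  shows "diag_block_mat Ms \<in> carrier_mat (length Ms * a) (length Ms * b)"
  using assms by (induction Ms) (auto simp: Let_def)

lemma diag_block_mat_index:
  assumes "\<And>M. M \<in> set Ms \<Longrightarrow> M \<in> carrier_mat a b" "i < length Ms * a" "j < length Ms * b"
  shows "diag_block_mat Ms $$ (i, j) =
    (if i div a = j div b then (Ms ! (i div a)) $$ (i mod a, j mod b) else 0)"
  using assms
proof (induction Ms arbitrary: i j)
  case (Cons M Ms)
  have M: "M \<in> carrier_mat a b" and D: "diag_block_mat Ms \<in> carrier_mat (length Ms * a) (length Ms * b)"
    using Cons.prems diag_block_mat_carrier[of Ms a b] by auto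
  have pos: "a > 0" "b > 0" using Cons.prems by (cases a; cases b; simp)+
  have head: "i div a = 0 \<longleftrightarrow> i < a" "j div b = 0 \<longleftrightarrow> j < b" using pos by (auto simp: div_eq_0_iff)
  have tail: "i div a = Suc ((i - a) div a) \<and> (i - a) mod a = i mod a" if "\<not> i < a"
    using that pos by (simp add: le_div_geq le_mod_geq)
  have tail': "j div b = Suc ((j - b) div b) \<and> (j - b) mod b = j mod b" if "\<not> j < b"
    using that pos by (simp add: le_div_geq le_mod_geq)
  have IH: "diag_block_mat Ms $$ (i - a, j - b) =
    (if (i - a) div a = (j - b) div b then (Ms ! ((i - a) div a)) $$ ((i - a) mod a, (j - b) mod b) else 0)"
    if "\<not> i < a" "\<not> j < b"
    using that Cons.prems by (intro Cons.IH) auto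
  have "diag_block_mat (M # Ms) $$ (i, j) =
    (if i < a then if j < b then M $$ (i, j) else 0 else if j < b then 0 else diag_block_mat Ms $$ (i - a, j - b))"
    using carrier_matD[OF M] carrier_matD[OF D] Cons.prems(2,3) by (simp add: Let_def)
  then show ?case
    using IH tail tail' head pos by (cases "i < a"; cases "j < b") auto
qed simp

lemma block_diagonal_eq_diag_block_mat:
  assumes X: "X \<in> carrier_mat (n * a) (n * b)"
    and off: "\<And>i j. i < n * a \<Longrightarrow> j < n * b \<Longrightarrow> i div a \<noteq> j div b \<Longrightarrow> X $$ (i, j) = 0"
  shows "X = diag_block_mat (map (\<lambda>k. block_of a b X k k) [0..<n])"
proof -
  let ?Ms = "map (\<lambda>k. block_of a b X k k) [0..<n]"
  have Ms: "M \<in> carrier_mat a b" if "M \<in> set ?Ms" for M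
    using that by (auto simp: block_of_def)
  have D: "diag_block_mat ?Ms \<in> carrier_mat (n * a) (n * b)"
    using diag_block_mat_carrier[of ?Ms a b, OF Ms] by simp
  show ?thesis
  proof (rule eq_matI)
    fix i j assume "i < dim_row (diag_block_mat ?Ms)" "j < dim_col (diag_block_mat ?Ms)"
    then have ij: "i < n * a" "j < n * b" using D by auto
    have "block_of a b X (i div a) (j div b) $$ (i mod a, j mod b) = X $$ (i, j)"
      using div_less_of_less_mult[OF ij(1)] div_less_of_less_mult[OF ij(2)]
      unfolding block_of_def by simp
    then show "X $$ (i, j) = diag_block_mat ?Ms $$ (i, j)"
      using diag_block_mat_index[of ?Ms a b i j, OF Ms] ij off[OF ij] div_less_of_less_mult[OF ij(1)]
      by (cases "i div a = j div b") simp_all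
  qed (use X D in auto)
qed

lemma fourier_transform_block_diagonal:
  assumes "shift_invariant n a b M"
  shows "fourier_transform n a b M
    = diag_block_mat (map (\<lambda>k. block_of a b (fourier_transform n a b M) k k) [0..<n])"
  using assms fourier_transform_off_diagonal fourier_transform_carrier
  by (intro block_diagonal_eq_diag_block_mat) (auto simp: shift_invariant_def)

section \<open>Block matrices and stacks\<close>

lemma mat_adjoint_block_diag:
  fixes X Y :: "complex mat"
  assumes "X \<in> carrier_mat a a" "Y \<in> carrier_mat b b"
  shows "mat_adjoint (four_block_mat X (0\<^sub>m a b) (0\<^sub>m b a) Y)
    = four_block_mat (mat_adjoint X) (0\<^sub>m a b) (0\<^sub>m b a) (mat_adjoint Y)"
proof -
  have F: "four_block_mat X (0\<^sub>m a b) (0\<^sub>m b a) Y \<in> carrier_mat (a + b) (a + b)"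
    using assms by auto
  note c = mat_adjoint_carrier[OF F] mat_adjoint_carrier[OF assms(1)] mat_adjoint_carrier[OF assms(2)]
  show ?thesis
    using assms c
    by (intro eq_matI) (auto simp: mat_adjoint_index[OF F] mat_adjoint_index[OF assms(1)]
        mat_adjoint_index[OF assms(2)])
qed

lemma block_diag_congruence:
  fixes X Y U V :: "complex mat"
  assumes X: "X \<in> carrier_mat a a" and Y: "Y \<in> carrier_mat b b"
    and U: "U \<in> carrier_mat c c" and V: "V \<in> carrier_mat d d"
    and A: "A \<in> carrier_mat a c" and B: "B \<in> carrier_mat a d"
    and C: "C \<in> carrier_mat b c" and D: "D \<in> carrier_mat b d"
  shows "mat_adjoint (four_block_mat X (0\<^sub>m a b) (0\<^sub>m b a) Y) * four_block_mat A B C D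
      * four_block_mat U (0\<^sub>m c d) (0\<^sub>m d c) V
    = four_block_mat (mat_adjoint X * A * U) (mat_adjoint X * B * V)
        (mat_adjoint Y * C * U) (mat_adjoint Y * D * V)"
proof -
  note X' = mat_adjoint_carrier[OF X] and Y' = mat_adjoint_carrier[OF Y]
  have c: "mat_adjoint X * A \<in> carrier_mat a c" "mat_adjoint X * B \<in> carrier_mat a d"
    "mat_adjoint Y * C \<in> carrier_mat b c" "mat_adjoint Y * D \<in> carrier_mat b d"
    "mat_adjoint X * A * U \<in> carrier_mat a c" "mat_adjoint X * B * V \<in> carrier_mat a d"
    "mat_adjoint Y * C * U \<in> carrier_mat b c" "mat_adjoint Y * D * V \<in> carrier_mat b d"
    using X' Y' A B C D U V by auto
  have "four_block_mat (mat_adjoint X) (0\<^sub>m a b) (0\<^sub>m b a) (mat_adjoint Y) * four_block_mat A B C D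
    = four_block_mat (mat_adjoint X * A) (mat_adjoint X * B) (mat_adjoint Y * C) (mat_adjoint Y * D)"
    by (subst mult_four_block_mat[OF X' zero_carrier_mat zero_carrier_mat Y' A B C D])
      (simp only: left_mult_zero_mat[OF A] left_mult_zero_mat[OF B] left_mult_zero_mat[OF C]
        left_mult_zero_mat[OF D] left_add_zero_mat[OF c(3)] left_add_zero_mat[OF c(4)]
        right_add_zero_mat[OF c(1)] right_add_zero_mat[OF c(2)])
  then show ?thesis
    unfolding mat_adjoint_block_diag[OF X Y]
    by (simp only: mult_four_block_mat[OF c(1-4) U zero_carrier_mat zero_carrier_mat V]
        right_mult_zero_mat[OF c(1)] right_mult_zero_mat[OF c(2)]
        right_mult_zero_mat[OF c(3)] right_mult_zero_mat[OF c(4)]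
        left_add_zero_mat[OF c(6)] left_add_zero_mat[OF c(8)]
        right_add_zero_mat[OF c(5)] right_add_zero_mat[OF c(7)])
qed

lemma stack_rows_Cons: "stack_rows c (M # Ms) = M @\<^sub>r stack_rows c Ms"
  by (simp add: stack_rows_def)

lemma stack_rows_carrier:
  assumes "\<And>M. M \<in> set Ms \<Longrightarrow> M \<in> carrier_mat r c"
  shows "stack_rows c Ms \<in> carrier_mat (length Ms * r) c"
  using assms
proof (induction Ms)
  case Nil
  then show ?case by (simp add: stack_rows_def)
next
  case (Cons M Ms)
  have "M \<in> carrier_mat r c" "stack_rows c Ms \<in> carrier_mat (length Ms * r) c"
    using Cons by auto
  then have "M @\<^sub>r stack_rows c Ms \<in> carrier_mat (r + length Ms * r) c" by (rule carrier_append_rows)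
  then show ?case by (simp add: stack_rows_Cons)
qed

lemma stack_rows_index:
  assumes "\<And>M. M \<in> set Ms \<Longrightarrow> M \<in> carrier_mat r c" "i < length Ms * r" "j < c"
  shows "stack_rows c Ms $$ (i, j) = (Ms ! (i div r)) $$ (i mod r, j)"
  using assms
proof (induction Ms arbitrary: i)
  case (Cons M Ms)
  have M: "M \<in> carrier_mat r c" and S: "stack_rows c Ms \<in> carrier_mat (length Ms * r) c"
    using Cons.prems stack_rows_carrier[of Ms r c] by auto
  have r: "r > 0" using Cons.prems by (cases r) auto
  have "stack_rows c (M # Ms) $$ (i, j) = (if i < r then M $$ (i, j) else stack_rows c Ms $$ (i - r, j))"
    using carrier_matD[OF M] carrier_matD[OF S] Cons.prems(2,3) unfolding stack_rows_Cons append_rows_def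
    by simp
  also have "\<dots> = ((M # Ms) ! (i div r)) $$ (i mod r, j)"
  proof (cases "i < r")
    case False
    then have "stack_rows c Ms $$ (i - r, j) = (Ms ! ((i - r) div r)) $$ ((i - r) mod r, j)"
      using Cons.prems by (intro Cons.IH) auto
    then show ?thesis using False r by (simp add: le_div_geq le_mod_geq)
  qed simp
  finally show ?case .
qed simp

lemma map_mat_stack_rows:
  assumes "\<And>M. M \<in> set Ms \<Longrightarrow> M \<in> carrier_mat r c"
  shows "map_mat f (stack_rows c Ms) = stack_rows c (map (map_mat f) Ms)"
proof -
  have m: "N \<in> carrier_mat r c" if "N \<in> set (map (map_mat f) Ms)" for N
    using that assms by auto
  note S = stack_rows_carrier[of Ms r c, OF assms] stack_rows_carrier[of "map (map_mat f) Ms" r c, OF m]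
  have "map_mat f (stack_rows c Ms) $$ (i, j) = stack_rows c (map (map_mat f) Ms) $$ (i, j)"
    if ij: "i < length Ms * r" "j < c" for i j
  proof -
    note d = div_less_of_less_mult[OF ij(1)]
    have "Ms ! (i div r) \<in> carrier_mat r c" using d assms by simp
    then show ?thesis
      using S(1) ij d stack_rows_index[of Ms r c i j, OF assms] stack_rows_index[of "map (map_mat f) Ms" r c i j, OF m]
      by auto
  qed
  then show ?thesis using S by (intro eq_matI) auto
qed

lemma stack_rows_mult:
  fixes U :: "'a :: semiring_0 mat"
  assumes Ms: "\<And>M. M \<in> set Ms \<Longrightarrow> M \<in> carrier_mat r c" and U: "U \<in> carrier_mat c c'"
  shows "stack_rows c Ms * U = stack_rows c' (map (\<lambda>M. M * U) Ms)"
proof -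
  have m: "N \<in> carrier_mat r c'" if "N \<in> set (map (\<lambda>M. M * U) Ms)" for N
    using that mult_carrier_mat[OF Ms U] by auto
  note S = stack_rows_carrier[of Ms r c, OF Ms] stack_rows_carrier[of "map (\<lambda>M. M * U) Ms" r c', OF m]
  have "(stack_rows c Ms * U) $$ (i, j) = stack_rows c' (map (\<lambda>M. M * U) Ms) $$ (i, j)"
    if ij: "i < length Ms * r" "j < c'" for i j
  proof -
    note d = div_less_of_less_mult[OF ij(1)]
    have Mc: "Ms ! (i div r) \<in> carrier_mat r c" using d Ms by simp
    have "(stack_rows c Ms * U) $$ (i, j) = (\<Sum>k<c. stack_rows c Ms $$ (i, k) * U $$ (k, j))"
      by (rule index_mult_mat_sum[OF S(1) U ij])
    also have "\<dots> = (\<Sum>k<c. (Ms ! (i div r)) $$ (i mod r, k) * U $$ (k, j))"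
      using stack_rows_index[of Ms r c i, OF Ms ij(1)] by (intro sum.cong) auto
    also have "\<dots> = (Ms ! (i div r) * U) $$ (i mod r, j)"
      using index_mult_mat_sum[OF Mc U _ ij(2)] d by simp
    also have "\<dots> = stack_rows c' (map (\<lambda>M. M * U) Ms) $$ (i, j)"
      using stack_rows_index[of "map (\<lambda>M. M * U) Ms" r c' i j, OF m] ij d by simp
    finally show ?thesis .
  qed
  then show ?thesis using S U by (intro eq_matI) auto
qed

lemma kronecker_one_index:
  assumes "Y \<in> carrier_mat r r" "i < p * r" "j < p * r"
  shows "((1\<^sub>m p :: complex mat) \<otimes>\<^sub>K Y) $$ (i, j) = (if i div r = j div r then Y $$ (i mod r, j mod r) else 0)"
  using assms div_less_of_less_mult[OF assms(2)] div_less_of_less_mult[OF assms(3)]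
  unfolding kronecker_def by simp

text \<open>
  Once the summation index is split into the number of a block and the position inside it, the factor
  \<open>1\<^sub>m p\<close> leaves only the block of the row in question.
\<close>

lemma adjoint_kronecker_one_mult_stack_rows:
  fixes Y :: "complex mat"
  assumes Ms: "\<And>M. M \<in> set Ms \<Longrightarrow> M \<in> carrier_mat r c" and Y: "Y \<in> carrier_mat r r"
  shows "mat_adjoint (1\<^sub>m (length Ms) \<otimes>\<^sub>K Y) * stack_rows c Ms
    = stack_rows c (map (\<lambda>M. mat_adjoint Y * M) Ms)"
proof -
  let ?p = "length Ms"
  let ?K = "(1\<^sub>m ?p :: complex mat) \<otimes>\<^sub>K Y"
  let ?Ns = "map (\<lambda>M. mat_adjoint Y * M) Ms"
  have K: "?K \<in> carrier_mat (?p * r) (?p * r)"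
    using Y unfolding kronecker_def by auto
  note K' = mat_adjoint_carrier[OF K] and Y' = mat_adjoint_carrier[OF Y]
  have m: "N \<in> carrier_mat r c" if "N \<in> set ?Ns" for N
    using that mult_carrier_mat[OF Y' Ms] by auto
  note S = stack_rows_carrier[of Ms r c, OF Ms] stack_rows_carrier[of ?Ns r c, OF m]
  have "(mat_adjoint ?K * stack_rows c Ms) $$ (i, j) = stack_rows c ?Ns $$ (i, j)"
    if ij: "i < ?p * r" "j < c" for i j
  proof -
    note d = div_less_of_less_mult[OF ij(1)]
    have Mc: "Ms ! (i div r) \<in> carrier_mat r c" using d Ms by simp
    let ?g = "\<lambda>k. mat_adjoint ?K $$ (i, k) * stack_rows c Ms $$ (k, j)"
    have "(mat_adjoint ?K * stack_rows c Ms) $$ (i, j) = (\<Sum>k<?p * r. ?g k)"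
      by (rule index_mult_mat_sum[OF K' S(1) ij])
    also have "\<dots> = (\<Sum>q<?p. \<Sum>t<r. ?g (q * r + t))"
      by (rule sum_blocks)
    also have "\<dots> = (\<Sum>q<?p. \<Sum>t<r. if q = i div r then mat_adjoint Y $$ (i mod r, t) * (Ms ! q) $$ (t, j) else 0)"
    proof (intro sum.cong refl)
      fix q t assume "q \<in> {..<?p}" "t \<in> {..<r}"
      then have qt: "q < ?p" "t < r" "q * r + t < ?p * r" using block_index_less by auto
      show "?g (q * r + t) = (if q = i div r then mat_adjoint Y $$ (i mod r, t) * (Ms ! q) $$ (t, j) else 0)"
        using qt d mat_adjoint_index[OF K ij(1) qt(3)] kronecker_one_index[OF Y qt(3) ij(1)]
          stack_rows_index[of Ms r c "q * r + t" j, OF Ms qt(3) ij(2)]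
          mat_adjoint_index[OF Y, of "i mod r" t] by auto
    qed
    also have "\<dots> = (\<Sum>t<r. mat_adjoint Y $$ (i mod r, t) * (Ms ! (i div r)) $$ (t, j))"
      using d by (subst sum.swap) simp
    also have "\<dots> = (mat_adjoint Y * (Ms ! (i div r))) $$ (i mod r, j)"
      using index_mult_mat_sum[OF Y' Mc _ ij(2)] d by simp
    also have "\<dots> = stack_rows c ?Ns $$ (i, j)"
      using stack_rows_index[of ?Ns r c i j, OF m] ij d by simp
    finally show ?thesis .
  qed
  then show ?thesis using S K' by (intro eq_matI) auto
qed

text \<open>
  The outputs come in \<open>p\<close> groups, each of which is Fourier transformed by itself.
\<close>

lemma congruence_stack_rows:
  assumes "\<forall>i<p. C i \<in> carrier_mat (n * ny) (n * m)"
  shows "mat_adjoint (1\<^sub>m p \<otimes>\<^sub>K block_fourier n ny)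
      * map_mat complex_of_real (stack_rows (n * m) (map C [0..<p])) * block_fourier n m
    = stack_rows (n * m) (map (\<lambda>i. fourier_transform n ny m (C i)) [0..<p])"
proof -
  let ?Cs = "map C [0..<p]" and ?Ds = "map (\<lambda>i. map_mat complex_of_real (C i)) [0..<p]"
    and ?Es = "map (\<lambda>i. mat_adjoint (block_fourier n ny) * map_mat complex_of_real (C i)) [0..<p]"
  have C: "M \<in> carrier_mat (n * ny) (n * m)" if "M \<in> set ?Cs" for M using that assms by auto
  have D: "M \<in> carrier_mat (n * ny) (n * m)" if "M \<in> set ?Ds" for M using that assms by auto
  have E: "M \<in> carrier_mat (n * ny) (n * m)" if "M \<in> set ?Es" for M
    using that D mult_carrier_mat[OF mat_adjoint_carrier[OF block_fourier_carrier[of n ny]]] by auto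
  have "map_mat complex_of_real (stack_rows (n * m) ?Cs) = stack_rows (n * m) ?Ds"
    by (subst map_mat_stack_rows[OF C]) (simp_all add: o_def)
  moreover have "mat_adjoint (1\<^sub>m p \<otimes>\<^sub>K block_fourier n ny) * stack_rows (n * m) ?Ds
      = stack_rows (n * m) ?Es"
    using adjoint_kronecker_one_mult_stack_rows[of ?Ds "n * ny" "n * m", OF D block_fourier_carrier]
    by (simp add: o_def)
  moreover have "stack_rows (n * m) ?Es * block_fourier n m
      = stack_rows (n * m) (map (\<lambda>i. fourier_transform n ny m (C i)) [0..<p])"
    by (subst stack_rows_mult[OF E block_fourier_carrier]) (simp_all add: o_def fourier_transform_def)
  ultimately show ?thesis by simp
qed

lemma map_mat_zero_of_real: "map_mat complex_of_real (0\<^sub>m a b) = 0\<^sub>m a b"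
  by (intro eq_matI) auto

section \<open>The decomposition of the MPC problem\<close>

theorem theorem2:
  fixes n p nx nu ny T :: nat
    and A B C D Q R P Q_half :: "real mat"
    and x_t y_lo y_up :: "real vec"
    and \<psi>\<^sub>x \<psi>\<^sub>u \<psi>\<^sub>y :: "complex mat"
  assumes mpc: "block_circulant_mpc n p nx nu ny
      \<lparr> horizon = T, init_state = x_t, mat_A = A, mat_B = B, mat_C = C, mat_D = D,
        cost_Q = Q, cost_R = R, cost_P = P, y_lower = y_lo, y_upper = y_up \<rparr>"
    and R: "pos_def (n * nu) R"
    and Q: "pos_semidef (n * nx) Q"
    and controllable: "controllable A B"
    and Q_half: "is_psd_sqrt (n * nx) Q_half Q"
    and observable: "observable A Q_half"
    and P: "pos_def (n * nx) P"
    and dare: "solves_dare A B Q R P"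
    and \<psi>\<^sub>x: "\<psi>\<^sub>x = fourier_mat n \<otimes>\<^sub>K 1\<^sub>m nx"
    and \<psi>\<^sub>u: "\<psi>\<^sub>u = fourier_mat n \<otimes>\<^sub>K 1\<^sub>m nu"
    and \<psi>\<^sub>y: "\<psi>\<^sub>y = 1\<^sub>m p \<otimes>\<^sub>K (fourier_mat n \<otimes>\<^sub>K 1\<^sub>m ny)"
  shows "\<exists>(a :: nat \<Rightarrow> complex mat) (b :: nat \<Rightarrow> complex mat)
          (c :: nat \<Rightarrow> nat \<Rightarrow> complex mat) (d :: nat \<Rightarrow> nat \<Rightarrow> complex mat)
          (q :: nat \<Rightarrow> complex mat) (r :: nat \<Rightarrow> complex mat) (ph :: nat \<Rightarrow> complex mat).
     (\<forall>j<n. a j \<in> carrier_mat nx nx \<and> b j \<in> carrier_mat nx nu \<and>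
            (\<forall>i<p. c i j \<in> carrier_mat ny nx \<and> d i j \<in> carrier_mat ny nu) \<and>
            q j \<in> carrier_mat nx nx \<and> r j \<in> carrier_mat nu nu \<and> ph j \<in> carrier_mat nx nx) \<and>
     mat_adjoint (four_block_mat \<psi>\<^sub>x (0\<^sub>m (n * nx) (p * n * ny)) (0\<^sub>m (p * n * ny) (n * nx)) \<psi>\<^sub>y)
       * map_mat complex_of_real (four_block_mat A B C D)
       * four_block_mat \<psi>\<^sub>x (0\<^sub>m (n * nx) (n * nu)) (0\<^sub>m (n * nu) (n * nx)) \<psi>\<^sub>u
     = four_block_mat
         (diag_block_mat (map a [0..<n]))
         (diag_block_mat (map b [0..<n]))
         (stack_rows (n * nx) (map (\<lambda>i. diag_block_mat (map (c i) [0..<n])) [0..<p]))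
         (stack_rows (n * nu) (map (\<lambda>i. diag_block_mat (map (d i) [0..<n])) [0..<p])) \<and>
     mat_adjoint (four_block_mat \<psi>\<^sub>x (0\<^sub>m (n * nx) (n * nu)) (0\<^sub>m (n * nu) (n * nx)) \<psi>\<^sub>u)
       * map_mat complex_of_real
           (four_block_mat Q (0\<^sub>m (n * nx) (n * nu)) (0\<^sub>m (n * nu) (n * nx)) R)
       * four_block_mat \<psi>\<^sub>x (0\<^sub>m (n * nx) (n * nu)) (0\<^sub>m (n * nu) (n * nx)) \<psi>\<^sub>u
     = four_block_mat
         (diag_block_mat (map q [0..<n])) (0\<^sub>m (n * nx) (n * nu))
         (0\<^sub>m (n * nu) (n * nx)) (diag_block_mat (map r [0..<n])) \<and>
     mat_adjoint \<psi>\<^sub>x * map_mat complex_of_real P * \<psi>\<^sub>x = diag_block_mat (map ph [0..<n])"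
proof -
  have AB: "A \<in> block_circulant n nx nx" "B \<in> block_circulant n nx nu"
    "Q \<in> block_circulant n nx nx" "R \<in> block_circulant n nu nu"
    using mpc by (auto simp: block_circulant_mpc_def)
  obtain Cs Ds where Cs: "\<forall>i<p. Cs i \<in> block_circulant n ny nx"
      and C_eq: "C = stack_rows (n * nx) (map Cs [0..<p])"
    and Ds: "\<forall>i<p. Ds i \<in> block_circulant n ny nu"
      and D_eq: "D = stack_rows (n * nu) (map Ds [0..<p])"
    using mpc by (auto simp: block_circulant_mpc_def)
  note inv = AB[THEN block_circulant_shift_invariant]
  have invC: "shift_invariant n ny nx (Cs i)" "shift_invariant n ny nu (Ds i)" if "i < p" for i
    using that Cs Ds block_circulant_shift_invariant by auto
  have invP: "shift_invariant n nx nx P"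
    by (rule dare_solution_shift_invariant[OF inv R P Q_half observable dare])
  have car: "A \<in> carrier_mat (n * nx) (n * nx)" "B \<in> carrier_mat (n * nx) (n * nu)"
    "Q \<in> carrier_mat (n * nx) (n * nx)" "R \<in> carrier_mat (n * nu) (n * nu)"
    using inv by (auto simp: shift_invariant_def)
  have carC: "\<forall>i<p. Cs i \<in> carrier_mat (n * ny) (n * nx)" "\<forall>i<p. Ds i \<in> carrier_mat (n * ny) (n * nu)"
    using invC by (auto simp: shift_invariant_def)
  have list_carrier: "\<And>M. M \<in> set (map E [0..<p]) \<Longrightarrow> M \<in> carrier_mat k l"
    if "\<forall>i<p. E i \<in> carrier_mat k l" for E :: "nat \<Rightarrow> real mat" and k l
    using that by auto
  have C: "C \<in> carrier_mat (p * n * ny) (n * nx)" and D: "D \<in> carrier_mat (p * n * ny) (n * nu)"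
    unfolding C_eq D_eq
    using stack_rows_carrier[of "map Cs [0..<p]", OF carC(1)[THEN list_carrier]]
      stack_rows_carrier[of "map Ds [0..<p]", OF carC(2)[THEN list_carrier]]
    by (simp_all add: mult.assoc)
  note \<psi> = \<psi>\<^sub>x[folded block_fourier_def] \<psi>\<^sub>u[folded block_fourier_def] \<psi>\<^sub>y[folded block_fourier_def]
  have \<psi>x: "\<psi>\<^sub>x \<in> carrier_mat (n * nx) (n * nx)" and \<psi>u: "\<psi>\<^sub>u \<in> carrier_mat (n * nu) (n * nu)"
    unfolding \<psi> by (rule block_fourier_carrier)+
  have \<psi>y: "\<psi>\<^sub>y \<in> carrier_mat (p * n * ny) (p * n * ny)"
    unfolding \<psi> kronecker_def using block_fourier_carrier[of n ny] by (auto simp: mult.assoc)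
  note of_real_car = map_carrier_mat[THEN iffD2, of _ _ _ complex_of_real]
  define diag where "diag a b M = (\<lambda>k. block_of a b (fourier_transform n a b M) k k)" for a b M
  have diag: "fourier_transform n a b M = diag_block_mat (map (diag a b M) [0..<n])"
    if "shift_invariant n a b M" for a b M
    unfolding diag_def by (rule fourier_transform_block_diagonal[OF that])
  have diag_car: "diag a b M k \<in> carrier_mat a b" for a b M k
    by (simp add: diag_def block_of_def)
  have stackC: "mat_adjoint \<psi>\<^sub>y * map_mat complex_of_real C * \<psi>\<^sub>x
      = stack_rows (n * nx) (map (\<lambda>i. diag_block_mat (map (diag ny nx (Cs i)) [0..<n])) [0..<p])"
    unfolding \<psi> C_eq congruence_stack_rows[OF carC(1)]
    using diag[OF invC(1)] by (intro arg_cong[of _ _ "stack_rows (n * nx)"]) auto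
  have stackD: "mat_adjoint \<psi>\<^sub>y * map_mat complex_of_real D * \<psi>\<^sub>u
      = stack_rows (n * nu) (map (\<lambda>i. diag_block_mat (map (diag ny nu (Ds i)) [0..<n])) [0..<p])"
    unfolding \<psi> D_eq congruence_stack_rows[OF carC(2)]
    using diag[OF invC(2)] by (intro arg_cong[of _ _ "stack_rows (n * nu)"]) auto
  have dynamics: "mat_adjoint (four_block_mat \<psi>\<^sub>x (0\<^sub>m (n * nx) (p * n * ny)) (0\<^sub>m (p * n * ny) (n * nx)) \<psi>\<^sub>y)
       * map_mat complex_of_real (four_block_mat A B C D)
       * four_block_mat \<psi>\<^sub>x (0\<^sub>m (n * nx) (n * nu)) (0\<^sub>m (n * nu) (n * nx)) \<psi>\<^sub>u
     = four_block_mat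
         (diag_block_mat (map (diag nx nx A) [0..<n]))
         (diag_block_mat (map (diag nx nu B) [0..<n]))
         (stack_rows (n * nx) (map (\<lambda>i. diag_block_mat (map (diag ny nx (Cs i)) [0..<n])) [0..<p]))
         (stack_rows (n * nu) (map (\<lambda>i. diag_block_mat (map (diag ny nu (Ds i)) [0..<n])) [0..<p]))"
    unfolding map_four_block_mat[OF car(1,2) C D]
      block_diag_congruence[OF \<psi>x \<psi>y \<psi>x \<psi>u of_real_car[OF car(1)] of_real_car[OF car(2)]
        of_real_car[OF C] of_real_car[OF D]] stackC stackD
    unfolding diag[OF inv(1), symmetric] diag[OF inv(2), symmetric]
    unfolding \<psi> fourier_transform_def ..
  have zero: "mat_adjoint \<psi>\<^sub>x * 0\<^sub>m (n * nx) (n * nu) * \<psi>\<^sub>u = 0\<^sub>m (n * nx) (n * nu)"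
    "mat_adjoint \<psi>\<^sub>u * 0\<^sub>m (n * nu) (n * nx) * \<psi>\<^sub>x = 0\<^sub>m (n * nu) (n * nx)"
    unfolding right_mult_zero_mat[OF mat_adjoint_carrier[OF \<psi>x]]
      right_mult_zero_mat[OF mat_adjoint_carrier[OF \<psi>u]]
      left_mult_zero_mat[OF \<psi>x] left_mult_zero_mat[OF \<psi>u] by (rule refl)+
  have objective: "mat_adjoint (four_block_mat \<psi>\<^sub>x (0\<^sub>m (n * nx) (n * nu)) (0\<^sub>m (n * nu) (n * nx)) \<psi>\<^sub>u)
       * map_mat complex_of_real
           (four_block_mat Q (0\<^sub>m (n * nx) (n * nu)) (0\<^sub>m (n * nu) (n * nx)) R)
       * four_block_mat \<psi>\<^sub>x (0\<^sub>m (n * nx) (n * nu)) (0\<^sub>m (n * nu) (n * nx)) \<psi>\<^sub>u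
     = four_block_mat
         (diag_block_mat (map (diag nx nx Q) [0..<n])) (0\<^sub>m (n * nx) (n * nu))
         (0\<^sub>m (n * nu) (n * nx)) (diag_block_mat (map (diag nu nu R) [0..<n]))"
    unfolding map_four_block_mat[OF car(3) zero_carrier_mat zero_carrier_mat car(4)] map_mat_zero_of_real
      block_diag_congruence[OF \<psi>x \<psi>u \<psi>x \<psi>u of_real_car[OF car(3)] zero_carrier_mat zero_carrier_mat
        of_real_car[OF car(4)]] zero
    unfolding diag[OF inv(3), symmetric] diag[OF inv(4), symmetric]
    unfolding \<psi> fourier_transform_def ..
  have terminal: "mat_adjoint \<psi>\<^sub>x * map_mat complex_of_real P * \<psi>\<^sub>x
      = diag_block_mat (map (diag nx nx P) [0..<n])"
    unfolding diag[OF invP, symmetric] unfolding \<psi> fourier_transform_def ..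
  show ?thesis
    by (rule exI[of _ "diag nx nx A"], rule exI[of _ "diag nx nu B"],
        rule exI[of _ "\<lambda>i. diag ny nx (Cs i)"], rule exI[of _ "\<lambda>i. diag ny nu (Ds i)"],
        rule exI[of _ "diag nx nx Q"], rule exI[of _ "diag nu nu R"], rule exI[of _ "diag nx nx P"])
      (use diag_car dynamics objective terminal in blast)
qed

end
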